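(* Suppose $G$ is faithful and conservative. For every $\mathcal V$-functor $K : \mathcal C^{\mathrm{op}} \to \mathcal V$, the assignment $$\widetilde G(-) : \mathrm{Sub}_{\mathcal V}(K) \longrightarrow \mathrm{Sub}_{\mathcal U}(\widetilde G K),$$ sending the class of a monomorphism $r : R \rightarrowtail K$ to the class of $\widetilde G r : \widetilde G R \rightarrowtail \widetilde G K$, is an injective morphism of partially ordered sets.
   Context: Setting. $(\mathcal U,\otimes,*_{\mathcal U})$ and $(\mathcal V,\otimes,*_{\mathcal V})$ are symmetric monoidal closed categories, each satisfying (with $\mathcal W$ standing for either): (i) $\mathcal W$ is locally finitely presentable (so well-powered, with a dense generating set $\mathcal G_{\mathcal W}$ of finitely presentable objects); (ii) $\mathcal W$ is locally small as an unenriched category; (iii) as a self-enriched category, $\mathcal W$ has all small conical limits and colimits (so is tensored and cotensored over itself); (iv) finite tensor products of finitely presentable objects are finitely presentable; (v) $\mathcal W$ is regular in the sense of Barr. $G:\mathcal V\to\mathcal U$ is a lax monoidal functor with coherence morphisms $u:*_{\mathcal U}\to G( *_{\mathcal V})$, $m_{ab}:G(a)\otimes G(b)\to G(a\otimes b)$, and $G$ is right adjoint, in the 2-category of monoidal categories and lax monoidal functors, to $F:\mathcal U\to\mathcal V$, with unit $\eta:1\to GF$ and counit $\epsilon:FG\to 1$ ($F$ is then strong monoidal). $\mathcal C$ is a small $\mathcal V$-category (equivalent to one with a small set of objects). Base change. For a $\mathcal V$-category $\mathcal X$, $\mathcal X_0$ is its underlying category, $\mathcal X_0(x,y)=\mathrm{Hom}_{\mathcal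 V}( *_{\mathcal V},\mathcal X(x,y))$. $G_*\mathcal X$ is the $\mathcal U$-category with the same objects, $G_*\mathcal X(x,y)=G(\mathcal X(x,y))$, identities $G(\mathrm{id})\cdot u$, composition $G(\circ)\cdot m$. For a $\mathcal V$-functor $A:\mathcal X\to\mathcal Y$, $G_*A$ acts as $A$ on objects and by $G(A_{xy})$ on homs. Write $k(f)=G(f)\cdot u$ for a morphism $f: *_{\mathcal V}\to\mathcal X(x,y)$. The functor $\widetilde G$. The monoidal adjunction induces a $\mathcal U$-adjunction $F^{\mathcal U}:\mathcal U\leftrightarrows G_*\mathcal V:G^{\mathcal U}$, where $G^{\mathcal U}x=Gx$ on objects and $G^{\mathcal U}_{xy}:G(\mathcal V(x,y))\to\mathcal U(Gx,Gy)$ is $\Phi_{(Gx)y}\circ k(\epsilon_x)^*$, with $\Phi: G\mathcal V(Fx,y)\to\mathcal U(x,Gy)$ the isomorphism of hom-objects of the $\mathcal U$-adjunction and $k(\epsilon_x)^*$ precomposition with $k(\epsilon_x)$; on underlying morphisms it acts (under $\mathcal V_0\cong\mathcal V$, $\mathcal U_0\cong\mathcal U$) as $f\mapsto G(f)$. The unenriched functor $\widetilde G:[\mathcal C^{\mathrm{op}},\mathcal V]\to[G_*\mathcal C^{\mathrm{op}},\mathcal U]$ is $R\mapsto G^{\mathcal U}\circ(G_*R)$ on objects and sends $\{\alpha_x:*_{\mathcal V}\to\mathcal V(Ax,Bx)\}$ to $\{G^{\mathcal U}_{Ax,Bx}\circ k(\alpha_x):*_{\mathcal U}\to\mathcal U(GAx,GBx)\}$.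 Subobjects. For $\mathcal W\in\{\mathcal U,\mathcal V\}$, a monomorphism of $\mathcal W$-functors is a $\mathcal W$-natural transformation whose components are monomorphisms in $\mathcal W_0$. $\mathcal M_{\mathcal W}(K)$ is the class of monomorphisms with codomain $K$, preordered by: $(\alpha:A\to K)\ge(\beta:B\to K)$ iff $\beta=\alpha\sigma$ for some $\sigma:B\to A$. $\mathrm{Sub}_{\mathcal W}(K)$ is its quotient by the relation $r\sim s$ iff $r=st$ for an isomorphism $t$, with the induced partial order. *)

theory Defs
  imports Main "HOL-Library.FuncSet"
begin

unbundle cardinal_syntax

section \<open>Smallness\<close>

text \<open>The type 's plays the role of a Grothendieck universe: a set is small when its cardinality
  is strictly below that of 's.  The closure conditions are those of a universe; if the cardinality
  of 's is an inaccessible cardinal, one obtains the usual notion.  Uncountability is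
  deliberately not demanded, so that the conditions are satisfiable in plain HOL.\<close>

definition small :: "'s itself \<Rightarrow> 'x set \<Rightarrow> bool" where
  "small S A \<longleftrightarrow> |A| <o |UNIV :: 's set|"

definition universe :: "'s itself \<Rightarrow> bool" where
  "universe S \<longleftrightarrow>
     infinite (UNIV :: 's set) \<and>
     (\<forall>A :: 's set. small S A \<longrightarrow> small S (Pow A)) \<and>
     (\<forall>(I :: 's set) (B :: 's \<Rightarrow> 's set).
        small S I \<and> (\<forall>i\<in>I. small S (B i)) \<longrightarrow> small S (\<Union>i\<in>I. B i))"


section \<open>Categories\<close>

record ('o, 'a) cat =
  Obj :: "'o set"
  Arr :: "'a set"
  Dom :: "'a \<Rightarrow> 'o"
  Cod :: "'a \<Rightarrow> 'o"
  Idn :: "'o \<Rightarrow> 'a"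
  Comp :: "'a \<Rightarrow> 'a \<Rightarrow> 'a"  (infixl "\<cdot>\<index>" 65)

definition Hom :: "('o, 'a, 'm) cat_scheme \<Rightarrow> 'o \<Rightarrow> 'o \<Rightarrow> 'a set" where
  "Hom C x y = {f \<in> Arr C. Dom C f = x \<and> Cod C f = y}"

locale category =
  fixes C :: "('o, 'a, 'm) cat_scheme" (structure)
  assumes Dom_in: "f \<in> Arr C \<Longrightarrow> Dom C f \<in> Obj C"
    and Cod_in: "f \<in> Arr C \<Longrightarrow> Cod C f \<in> Obj C"
    and Idn_in: "x \<in> Obj C \<Longrightarrow> Idn C x \<in> Hom C x x"
    and Comp_in: "\<lbrakk>f \<in> Hom C x y; g \<in> Hom C y z\<rbrakk> \<Longrightarrow> g \<cdot> f \<in> Hom C x z"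
    and Comp_Idn: "f \<in> Hom C x y \<Longrightarrow> f \<cdot> Idn C x = f"
    and Idn_Comp: "f \<in> Hom C x y \<Longrightarrow> Idn C y \<cdot> f = f"
    and Comp_assoc: "\<lbrakk>f \<in> Hom C w x; g \<in> Hom C x y; h \<in> Hom C y z\<rbrakk>
                      \<Longrightarrow> (h \<cdot> g) \<cdot> f = h \<cdot> (g \<cdot> f)"

definition op_cat :: "('o, 'a, 'm) cat_scheme \<Rightarrow> ('o, 'a) cat" where
  "op_cat C = \<lparr>Obj = Obj C, Arr = Arr C, Dom = Cod C, Cod = Dom C, Idn = Idn C,
               Comp = (\<lambda>g f. f \<cdot>\<^bsub>C\<^esub> g)\<rparr>"

definition inverse_arrows :: "('o, 'a, 'm) cat_scheme \<Rightarrow> 'a \<Rightarrow> 'a \<Rightarrow> bool" where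
  "inverse_arrows C f g \<longleftrightarrow>
     f \<in> Arr C \<and> g \<in> Hom C (Cod C f) (Dom C f) \<and>
     g \<cdot>\<^bsub>C\<^esub> f = Idn C (Dom C f) \<and> f \<cdot>\<^bsub>C\<^esub> g = Idn C (Cod C f)"

definition is_iso :: "('o, 'a, 'm) cat_scheme \<Rightarrow> 'a \<Rightarrow> bool" where
  "is_iso C f \<longleftrightarrow> (\<exists>g. inverse_arrows C f g)"

definition inv_arr :: "('o, 'a, 'm) cat_scheme \<Rightarrow> 'a \<Rightarrow> 'a" where
  "inv_arr C f = (THE g. inverse_arrows C f g)"

definition monic :: "('o, 'a, 'm) cat_scheme \<Rightarrow> 'a \<Rightarrow> bool" where
  "monic C f \<longleftrightarrow>
     f \<in> Arr C \<and>
     (\<forall>w\<in>Obj C. \<forall>g\<in>Hom C w (Dom C f). \<forall>h\<in>Hom C w (Dom C f).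
        f \<cdot>\<^bsub>C\<^esub> g = f \<cdot>\<^bsub>C\<^esub> h \<longrightarrow> g = h)"

record ('o, 'a, 'p, 'b) ftor =
  FO :: "'o \<Rightarrow> 'p"
  FA :: "'a \<Rightarrow> 'b"

definition is_functor ::
  "('o, 'a, 'm) cat_scheme \<Rightarrow> ('p, 'b, 'n) cat_scheme \<Rightarrow> ('o, 'a, 'p, 'b, 'k) ftor_scheme \<Rightarrow> bool"
  where
  "is_functor C D F \<longleftrightarrow>
     (\<forall>x\<in>Obj C. FO F x \<in> Obj D) \<and>
     (\<forall>x\<in>Obj C. \<forall>y\<in>Obj C. \<forall>f\<in>Hom C x y. FA F f \<in> Hom D (FO F x) (FO F y)) \<and>
     (\<forall>x\<in>Obj C. FA F (Idn C x) = Idn D (FO F x)) \<and>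
     (\<forall>x\<in>Obj C. \<forall>y\<in>Obj C. \<forall>z\<in>Obj C. \<forall>f\<in>Hom C x y. \<forall>g\<in>Hom C y z.
        FA F (g \<cdot>\<^bsub>C\<^esub> f) = FA F g \<cdot>\<^bsub>D\<^esub> FA F f)"

definition faithful ::
  "('o, 'a, 'm) cat_scheme \<Rightarrow> ('o, 'a, 'p, 'b, 'k) ftor_scheme \<Rightarrow> bool" where
  "faithful C F \<longleftrightarrow>
     (\<forall>x\<in>Obj C. \<forall>y\<in>Obj C. \<forall>f\<in>Hom C x y. \<forall>g\<in>Hom C x y. FA F f = FA F g \<longrightarrow> f = g)"

definition conservative ::
  "('o, 'a, 'm) cat_scheme \<Rightarrow> ('p, 'b, 'n) cat_scheme \<Rightarrow> ('o, 'a, 'p, 'b, 'k) ftor_scheme \<Rightarrow> bool"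
  where
  "conservative C D F \<longleftrightarrow> (\<forall>f\<in>Arr C. is_iso D (FA F f) \<longrightarrow> is_iso C f)"


section \<open>Limits and colimits\<close>

definition is_cone ::
  "('o, 'a, 'm) cat_scheme \<Rightarrow> ('j, 'i, 'n) cat_scheme \<Rightarrow> ('j, 'i, 'o, 'a, 'k) ftor_scheme
    \<Rightarrow> 'o \<Rightarrow> ('j \<Rightarrow> 'a) \<Rightarrow> bool" where
  "is_cone C J D L l \<longleftrightarrow>
     L \<in> Obj C \<and>
     (\<forall>j\<in>Obj J. l j \<in> Hom C L (FO D j)) \<and>
     (\<forall>f\<in>Arr J. FA D f \<cdot>\<^bsub>C\<^esub> l (Dom J f) = l (Cod J f))"

definition is_limit ::
  "('o, 'a, 'm) cat_scheme \<Rightarrow> ('j, 'i, 'n) cat_scheme \<Rightarrow> ('j, 'i, 'o, 'a, 'k) ftor_scheme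
    \<Rightarrow> 'o \<Rightarrow> ('j \<Rightarrow> 'a) \<Rightarrow> bool" where
  "is_limit C J D L l \<longleftrightarrow>
     is_cone C J D L l \<and>
     (\<forall>X m. is_cone C J D X m \<longrightarrow>
        (\<exists>!h. h \<in> Hom C X L \<and> (\<forall>j\<in>Obj J. l j \<cdot>\<^bsub>C\<^esub> h = m j)))"

definition is_colimit ::
  "('o, 'a, 'm) cat_scheme \<Rightarrow> ('j, 'i, 'n) cat_scheme \<Rightarrow> ('j, 'i, 'o, 'a, 'k) ftor_scheme
    \<Rightarrow> 'o \<Rightarrow> ('j \<Rightarrow> 'a) \<Rightarrow> bool" where
  "is_colimit C J D L l \<longleftrightarrow> is_limit (op_cat C) (op_cat J) D L l"

definition small_category :: "'s itself \<Rightarrow> ('j, 'i, 'n) cat_scheme \<Rightarrow> bool" where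
  "small_category S J \<longleftrightarrow> category J \<and> small S (Obj J) \<and> small S (Arr J)"

definition filtered :: "('j, 'i, 'n) cat_scheme \<Rightarrow> bool" where
  "filtered J \<longleftrightarrow>
     Obj J \<noteq> {} \<and>
     (\<forall>i\<in>Obj J. \<forall>j\<in>Obj J. \<exists>k\<in>Obj J. Hom J i k \<noteq> {} \<and> Hom J j k \<noteq> {}) \<and>
     (\<forall>i\<in>Obj J. \<forall>j\<in>Obj J. \<forall>f\<in>Hom J i j. \<forall>g\<in>Hom J i j.
        \<exists>k\<in>Obj J. \<exists>h\<in>Hom J j k. h \<cdot>\<^bsub>J\<^esub> f = h \<cdot>\<^bsub>J\<^esub> g)"

text \<open>Every small category is isomorphic to one whose objects and arrows are elements of 's, so
  quantification over small index categories is quantification over ('s, 's) cat.\<close>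

definition small_cocomplete :: "'s itself \<Rightarrow> ('o, 'a, 'm) cat_scheme \<Rightarrow> bool" where
  "small_cocomplete S C \<longleftrightarrow>
     (\<forall>(J :: ('s, 's) cat) (D :: ('s, 's, 'o, 'a) ftor).
        small_category S J \<and> is_functor J C D \<longrightarrow> (\<exists>L l. is_colimit C J D L l))"

definition locally_small :: "'s itself \<Rightarrow> ('o, 'a, 'm) cat_scheme \<Rightarrow> bool" where
  "locally_small S C \<longleftrightarrow> (\<forall>x\<in>Obj C. \<forall>y\<in>Obj C. small S (Hom C x y))"

text \<open>An object x is finitely presentable when Hom(x, -) preserves small filtered colimits.  The
  preserved colimit lives in the category of sets: below, its universal property is written out for
  functions into test sets T of elements of type ('s * 'a) set.  This type is large enough to hold
  the actual colimit, a quotient of the disjoint union of the sets Hom(x, D j).\<close>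

definition finitely_presentable ::
  "'s itself \<Rightarrow> ('o, 'a, 'm) cat_scheme \<Rightarrow> 'o \<Rightarrow> bool" where
  "finitely_presentable S C x \<longleftrightarrow>
     x \<in> Obj C \<and>
     (\<forall>(J :: ('s, 's) cat) (D :: ('s, 's, 'o, 'a) ftor) L l.
        small_category S J \<and> filtered J \<and> is_functor J C D \<and> is_colimit C J D L l \<longrightarrow>
        (\<forall>(T :: ('s \<times> 'a) set set) t.
           (\<forall>j\<in>Obj J. t j \<in> Hom C x (FO D j) \<rightarrow> T) \<and>
           (\<forall>f\<in>Arr J. \<forall>e\<in>Hom C x (FO D (Dom J f)).
              t (Cod J f) (FA D f \<cdot>\<^bsub>C\<^esub> e) = t (Dom J f) e) \<longrightarrow>
           (\<exists>!h. h \<in> Hom C x L \<rightarrow>\<^sub>E T \<and>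
              (\<forall>j\<in>Obj J. \<forall>e\<in>Hom C x (FO D j). h (l j \<cdot>\<^bsub>C\<^esub> e) = t j e))))"

definition locally_finitely_presentable :: "'s itself \<Rightarrow> ('o, 'a, 'm) cat_scheme \<Rightarrow> bool" where
  "locally_finitely_presentable S C \<longleftrightarrow>
     small_cocomplete S C \<and>
     (\<exists>P. small S P \<and> (\<forall>p\<in>P. finitely_presentable S C p) \<and>
        (\<forall>x\<in>Obj C. \<exists>(J :: ('s, 's) cat) (D :: ('s, 's, 'o, 'a) ftor) l.
           small_category S J \<and> filtered J \<and> is_functor J C D \<and>
           (\<forall>j\<in>Obj J. FO D j \<in> P) \<and> is_colimit C J D x l))"

definition is_terminal :: "('o, 'a, 'm) cat_scheme \<Rightarrow> 'o \<Rightarrow> bool" where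
  "is_terminal C t \<longleftrightarrow> t \<in> Obj C \<and> (\<forall>x\<in>Obj C. \<exists>!f. f \<in> Hom C x t)"

definition is_pullback :: "('o, 'a, 'm) cat_scheme \<Rightarrow> 'a \<Rightarrow> 'a \<Rightarrow> 'a \<Rightarrow> 'a \<Rightarrow> bool" where
  "is_pullback C f g p q \<longleftrightarrow>
     f \<in> Arr C \<and> g \<in> Arr C \<and> Cod C f = Cod C g \<and>
     p \<in> Hom C (Dom C p) (Dom C f) \<and> q \<in> Hom C (Dom C p) (Dom C g) \<and>
     f \<cdot>\<^bsub>C\<^esub> p = g \<cdot>\<^bsub>C\<^esub> q \<and>
     (\<forall>w\<in>Obj C. \<forall>a\<in>Hom C w (Dom C f). \<forall>b\<in>Hom C w (Dom C g).
        f \<cdot>\<^bsub>C\<^esub> a = g \<cdot>\<^bsub>C\<^esub> b \<longrightarrow>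
        (\<exists>!h. h \<in> Hom C w (Dom C p) \<and> p \<cdot>\<^bsub>C\<^esub> h = a \<and> q \<cdot>\<^bsub>C\<^esub> h = b))"

definition is_coequalizer :: "('o, 'a, 'm) cat_scheme \<Rightarrow> 'a \<Rightarrow> 'a \<Rightarrow> 'a \<Rightarrow> bool" where
  "is_coequalizer C a b e \<longleftrightarrow>
     a \<in> Arr C \<and> b \<in> Hom C (Dom C a) (Cod C a) \<and> e \<in> Hom C (Cod C a) (Cod C e) \<and>
     e \<cdot>\<^bsub>C\<^esub> a = e \<cdot>\<^bsub>C\<^esub> b \<and>
     (\<forall>w\<in>Obj C. \<forall>f\<in>Hom C (Cod C a) w.
        f \<cdot>\<^bsub>C\<^esub> a = f \<cdot>\<^bsub>C\<^esub> b \<longrightarrow> (\<exists>!h. h \<in> Hom C (Cod C e) w \<and> h \<cdot>\<^bsub>C\<^esub> e = f))"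

definition regular_epi :: "('o, 'a, 'm) cat_scheme \<Rightarrow> 'a \<Rightarrow> bool" where
  "regular_epi C e \<longleftrightarrow> (\<exists>a b. is_coequalizer C a b e)"

definition regular_category :: "('o, 'a, 'm) cat_scheme \<Rightarrow> bool" where
  "regular_category C \<longleftrightarrow>
     (\<exists>t. is_terminal C t) \<and>
     (\<forall>f\<in>Arr C. \<forall>g\<in>Arr C. Cod C f = Cod C g \<longrightarrow> (\<exists>p q. is_pullback C f g p q)) \<and>
     (\<forall>f p q. is_pullback C f f p q \<longrightarrow> (\<exists>e. is_coequalizer C p q e)) \<and>
     (\<forall>f g p q. is_pullback C f g p q \<and> regular_epi C f \<longrightarrow> regular_epi C q)"


section \<open>Symmetric monoidal closed categories\<close>

text \<open>The tensor product is written with the symbol odot on objects and with the symbol otimes on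
  arrows.  The evaluation ev x y goes from ihom x y (.) x to y.\<close>

record ('o, 'a) smcc = "('o, 'a) cat" +
  tens :: "'o \<Rightarrow> 'o \<Rightarrow> 'o"  (infixr "\<odot>\<index>" 75)
  tensA :: "'a \<Rightarrow> 'a \<Rightarrow> 'a"  (infixr "\<otimes>\<index>" 75)
  unt :: "'o"
  asc :: "'o \<Rightarrow> 'o \<Rightarrow> 'o \<Rightarrow> 'a"
  lun :: "'o \<Rightarrow> 'a"
  run :: "'o \<Rightarrow> 'a"
  brd :: "'o \<Rightarrow> 'o \<Rightarrow> 'a"
  ihom :: "'o \<Rightarrow> 'o \<Rightarrow> 'o"
  ev :: "'o \<Rightarrow> 'o \<Rightarrow> 'a"

locale symmetric_monoidal_closed = category W
  for W :: "('o, 'a) smcc" (structure) +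
  assumes tens_in: "\<lbrakk>x \<in> Obj W; y \<in> Obj W\<rbrakk> \<Longrightarrow> x \<odot> y \<in> Obj W"
    and tensA_in: "\<lbrakk>f \<in> Hom W x x'; g \<in> Hom W y y'\<rbrakk> \<Longrightarrow> f \<otimes> g \<in> Hom W (x \<odot> y) (x' \<odot> y')"
    and tensA_Idn: "\<lbrakk>x \<in> Obj W; y \<in> Obj W\<rbrakk> \<Longrightarrow> Idn W x \<otimes> Idn W y = Idn W (x \<odot> y)"
    and tensA_Comp: "\<lbrakk>f \<in> Hom W x x'; f' \<in> Hom W x' x''; g \<in> Hom W y y'; g' \<in> Hom W y' y''\<rbrakk>
      \<Longrightarrow> (f' \<cdot> f) \<otimes> (g' \<cdot> g) = (f' \<otimes> g') \<cdot> (f \<otimes> g)"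
    and unt_in: "unt W \<in> Obj W"
    and asc_in: "\<lbrakk>x \<in> Obj W; y \<in> Obj W; z \<in> Obj W\<rbrakk>
      \<Longrightarrow> asc W x y z \<in> Hom W ((x \<odot> y) \<odot> z) (x \<odot> (y \<odot> z)) \<and> is_iso W (asc W x y z)"
    and asc_nat: "\<lbrakk>f \<in> Hom W x x'; g \<in> Hom W y y'; h \<in> Hom W z z'\<rbrakk>
      \<Longrightarrow> asc W x' y' z' \<cdot> ((f \<otimes> g) \<otimes> h) = (f \<otimes> (g \<otimes> h)) \<cdot> asc W x y z"
    and lun_in: "x \<in> Obj W \<Longrightarrow> lun W x \<in> Hom W (unt W \<odot> x) x \<and> is_iso W (lun W x)"
    and lun_nat: "f \<in> Hom W x x' \<Longrightarrow> lun W x' \<cdot> (Idn W (unt W) \<otimes> f) = f \<cdot> lun W x"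
    and run_in: "x \<in> Obj W \<Longrightarrow> run W x \<in> Hom W (x \<odot> unt W) x \<and> is_iso W (run W x)"
    and run_nat: "f \<in> Hom W x x' \<Longrightarrow> run W x' \<cdot> (f \<otimes> Idn W (unt W)) = f \<cdot> run W x"
    and pentagon: "\<lbrakk>w \<in> Obj W; x \<in> Obj W; y \<in> Obj W; z \<in> Obj W\<rbrakk>
      \<Longrightarrow> (Idn W w \<otimes> asc W x y z) \<cdot> asc W w (x \<odot> y) z \<cdot> (asc W w x y \<otimes> Idn W z)
          = asc W w x (y \<odot> z) \<cdot> asc W (w \<odot> x) y z"
    and triangle: "\<lbrakk>x \<in> Obj W; y \<in> Obj W\<rbrakk>
      \<Longrightarrow> (Idn W x \<otimes> lun W y) \<cdot> asc W x (unt W) y = run W x \<otimes> Idn W y"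
    and brd_in: "\<lbrakk>x \<in> Obj W; y \<in> Obj W\<rbrakk> \<Longrightarrow> brd W x y \<in> Hom W (x \<odot> y) (y \<odot> x)"
    and brd_nat: "\<lbrakk>f \<in> Hom W x x'; g \<in> Hom W y y'\<rbrakk>
      \<Longrightarrow> brd W x' y' \<cdot> (f \<otimes> g) = (g \<otimes> f) \<cdot> brd W x y"
    and brd_sym: "\<lbrakk>x \<in> Obj W; y \<in> Obj W\<rbrakk> \<Longrightarrow> brd W y x \<cdot> brd W x y = Idn W (x \<odot> y)"
    and hexagon: "\<lbrakk>x \<in> Obj W; y \<in> Obj W; z \<in> Obj W\<rbrakk>
      \<Longrightarrow> asc W y z x \<cdot> brd W x (y \<odot> z) \<cdot> asc W x y z
          = (Idn W y \<otimes> brd W x z) \<cdot> asc W y x z \<cdot> (brd W x y \<otimes> Idn W z)"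
    and ihom_in: "\<lbrakk>x \<in> Obj W; y \<in> Obj W\<rbrakk> \<Longrightarrow> ihom W x y \<in> Obj W"
    and ev_in: "\<lbrakk>x \<in> Obj W; y \<in> Obj W\<rbrakk> \<Longrightarrow> ev W x y \<in> Hom W (ihom W x y \<odot> x) y"
    and curry_ex1: "\<lbrakk>x \<in> Obj W; y \<in> Obj W; z \<in> Obj W; f \<in> Hom W (z \<odot> x) y\<rbrakk>
      \<Longrightarrow> \<exists>!g. g \<in> Hom W z (ihom W x y) \<and> ev W x y \<cdot> (g \<otimes> Idn W x) = f"

definition curry :: "('o, 'a) smcc \<Rightarrow> 'o \<Rightarrow> 'o \<Rightarrow> 'o \<Rightarrow> 'a \<Rightarrow> 'a" where
  "curry W z x y f =
     (THE g. g \<in> Hom W z (ihom W x y) \<and> ev W x y \<cdot>\<^bsub>W\<^esub> (g \<otimes>\<^bsub>W\<^esub> Idn W x) = f)"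


section \<open>Monoidal adjunctions\<close>

text \<open>The field lu is the coherence arrow on units and lm the one on binary tensor products.\<close>

record ('o, 'a, 'p, 'b) lax = "('o, 'a, 'p, 'b) ftor" +
  lu :: "'b"
  lm :: "'o \<Rightarrow> 'o \<Rightarrow> 'b"

definition lax_monoidal ::
  "('o, 'a) smcc \<Rightarrow> ('p, 'b) smcc \<Rightarrow> ('o, 'a, 'p, 'b) lax \<Rightarrow> bool" where
  "lax_monoidal V U G \<longleftrightarrow>
     is_functor V U G \<and>
     lu G \<in> Hom U (unt U) (FO G (unt V)) \<and>
     (\<forall>a\<in>Obj V. \<forall>b\<in>Obj V. lm G a b \<in> Hom U (FO G a \<odot>\<^bsub>U\<^esub> FO G b) (FO G (a \<odot>\<^bsub>V\<^esub> b))) \<and>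
     (\<forall>a\<in>Obj V. \<forall>a'\<in>Obj V. \<forall>b\<in>Obj V. \<forall>b'\<in>Obj V. \<forall>f\<in>Hom V a a'. \<forall>g\<in>Hom V b b'.
        lm G a' b' \<cdot>\<^bsub>U\<^esub> (FA G f \<otimes>\<^bsub>U\<^esub> FA G g) = FA G (f \<otimes>\<^bsub>V\<^esub> g) \<cdot>\<^bsub>U\<^esub> lm G a b) \<and>
     (\<forall>a\<in>Obj V. \<forall>b\<in>Obj V. \<forall>c\<in>Obj V.
        FA G (asc V a b c) \<cdot>\<^bsub>U\<^esub> lm G (a \<odot>\<^bsub>V\<^esub> b) c \<cdot>\<^bsub>U\<^esub> (lm G a b \<otimes>\<^bsub>U\<^esub> Idn U (FO G c))
        = lm G a (b \<odot>\<^bsub>V\<^esub> c) \<cdot>\<^bsub>U\<^esub> (Idn U (FO G a) \<otimes>\<^bsub>U\<^esub> lm G b c)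
            \<cdot>\<^bsub>U\<^esub> asc U (FO G a) (FO G b) (FO G c)) \<and>
     (\<forall>a\<in>Obj V.
        FA G (lun V a) \<cdot>\<^bsub>U\<^esub> lm G (unt V) a \<cdot>\<^bsub>U\<^esub> (lu G \<otimes>\<^bsub>U\<^esub> Idn U (FO G a)) = lun U (FO G a)) \<and>
     (\<forall>a\<in>Obj V.
        FA G (run V a) \<cdot>\<^bsub>U\<^esub> lm G a (unt V) \<cdot>\<^bsub>U\<^esub> (Idn U (FO G a) \<otimes>\<^bsub>U\<^esub> lu G) = run U (FO G a))"

definition lax_id :: "('o, 'a) smcc \<Rightarrow> ('o, 'a, 'o, 'a) lax" where
  "lax_id W = \<lparr>FO = (\<lambda>x. x), FA = (\<lambda>f. f), lu = Idn W (unt W),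
               lm = (\<lambda>a b. Idn W (a \<odot>\<^bsub>W\<^esub> b))\<rparr>"

definition lax_comp ::
  "('q, 'c) smcc \<Rightarrow> ('p, 'b, 'q, 'c) lax \<Rightarrow> ('o, 'a, 'p, 'b) lax \<Rightarrow> ('o, 'a, 'q, 'c) lax" where
  "lax_comp W G F = \<lparr>FO = FO G \<circ> FO F, FA = FA G \<circ> FA F,
     lu = FA G (lu F) \<cdot>\<^bsub>W\<^esub> lu G,
     lm = (\<lambda>a b. FA G (lm F a b) \<cdot>\<^bsub>W\<^esub> lm G (FO F a) (FO F b))\<rparr>"

definition monoidal_nat ::
  "('o, 'a) smcc \<Rightarrow> ('p, 'b) smcc \<Rightarrow> ('o, 'a, 'p, 'b) lax \<Rightarrow> ('o, 'a, 'p, 'b) lax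
    \<Rightarrow> ('o \<Rightarrow> 'b) \<Rightarrow> bool" where
  "monoidal_nat V U P Q t \<longleftrightarrow>
     (\<forall>a\<in>Obj V. t a \<in> Hom U (FO P a) (FO Q a)) \<and>
     (\<forall>a\<in>Obj V. \<forall>b\<in>Obj V. \<forall>f\<in>Hom V a b. t b \<cdot>\<^bsub>U\<^esub> FA P f = FA Q f \<cdot>\<^bsub>U\<^esub> t a) \<and>
     t (unt V) \<cdot>\<^bsub>U\<^esub> lu P = lu Q \<and>
     (\<forall>a\<in>Obj V. \<forall>b\<in>Obj V. t (a \<odot>\<^bsub>V\<^esub> b) \<cdot>\<^bsub>U\<^esub> lm P a b = lm Q a b \<cdot>\<^bsub>U\<^esub> (t a \<otimes>\<^bsub>U\<^esub> t b))"

text \<open>An adjunction F -| G in the 2-category of monoidal categories and lax monoidal functors.\<close>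

definition monoidal_adjunction ::
  "('u, 'g) smcc \<Rightarrow> ('v, 'f) smcc \<Rightarrow> ('u, 'g, 'v, 'f) lax \<Rightarrow> ('v, 'f, 'u, 'g) lax
    \<Rightarrow> ('u \<Rightarrow> 'g) \<Rightarrow> ('v \<Rightarrow> 'f) \<Rightarrow> bool" where
  "monoidal_adjunction U V F G eta eps \<longleftrightarrow>
     lax_monoidal U V F \<and> lax_monoidal V U G \<and>
     monoidal_nat U U (lax_id U) (lax_comp U G F) eta \<and>
     monoidal_nat V V (lax_comp V F G) (lax_id V) eps \<and>
     (\<forall>x\<in>Obj U. eps (FO F x) \<cdot>\<^bsub>V\<^esub> FA F (eta x) = Idn V (FO F x)) \<and>
     (\<forall>y\<in>Obj V. FA G (eps y) \<cdot>\<^bsub>U\<^esub> eta (FO G y) = Idn U (FO G y))"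


section \<open>Enriched categories\<close>

text \<open>EComp X x y z goes from X(y,z) (.) X(x,y) to X(x,z).\<close>

record ('x, 'o, 'a) ecat =
  EObj :: "'x set"
  EHom :: "'x \<Rightarrow> 'x \<Rightarrow> 'o"
  EId :: "'x \<Rightarrow> 'a"
  EComp :: "'x \<Rightarrow> 'x \<Rightarrow> 'x \<Rightarrow> 'a"

definition enriched_category :: "('o, 'a) smcc \<Rightarrow> ('x, 'o, 'a) ecat \<Rightarrow> bool" where
  "enriched_category W X \<longleftrightarrow>
     (\<forall>x\<in>EObj X. \<forall>y\<in>EObj X. EHom X x y \<in> Obj W) \<and>
     (\<forall>x\<in>EObj X. EId X x \<in> Hom W (unt W) (EHom X x x)) \<and>
     (\<forall>x\<in>EObj X. \<forall>y\<in>EObj X. \<forall>z\<in>EObj X.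
        EComp X x y z \<in> Hom W (EHom X y z \<odot>\<^bsub>W\<^esub> EHom X x y) (EHom X x z)) \<and>
     (\<forall>w\<in>EObj X. \<forall>x\<in>EObj X. \<forall>y\<in>EObj X. \<forall>z\<in>EObj X.
        EComp X w x z \<cdot>\<^bsub>W\<^esub> (EComp X x y z \<otimes>\<^bsub>W\<^esub> Idn W (EHom X w x))
        = EComp X w y z \<cdot>\<^bsub>W\<^esub> (Idn W (EHom X y z) \<otimes>\<^bsub>W\<^esub> EComp X w x y)
            \<cdot>\<^bsub>W\<^esub> asc W (EHom X y z) (EHom X x y) (EHom X w x)) \<and>
     (\<forall>x\<in>EObj X. \<forall>y\<in>EObj X.
        EComp X x y y \<cdot>\<^bsub>W\<^esub> (EId X y \<otimes>\<^bsub>W\<^esub> Idn W (EHom X x y)) = lun W (EHom X x y) \<and>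
        EComp X x x y \<cdot>\<^bsub>W\<^esub> (Idn W (EHom X x y) \<otimes>\<^bsub>W\<^esub> EId X x) = run W (EHom X x y))"

record ('x, 'y, 'a) efun =
  EFO :: "'x \<Rightarrow> 'y"
  EFA :: "'x \<Rightarrow> 'x \<Rightarrow> 'a"

definition enriched_functor ::
  "('o, 'a) smcc \<Rightarrow> ('x, 'o, 'a) ecat \<Rightarrow> ('y, 'o, 'a) ecat \<Rightarrow> ('x, 'y, 'a) efun \<Rightarrow> bool" where
  "enriched_functor W X Y A \<longleftrightarrow>
     (\<forall>x\<in>EObj X. EFO A x \<in> EObj Y) \<and>
     (\<forall>x\<in>EObj X. \<forall>y\<in>EObj X. EFA A x y \<in> Hom W (EHom X x y) (EHom Y (EFO A x) (EFO A y))) \<and>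
     (\<forall>x\<in>EObj X. EFA A x x \<cdot>\<^bsub>W\<^esub> EId X x = EId Y (EFO A x)) \<and>
     (\<forall>x\<in>EObj X. \<forall>y\<in>EObj X. \<forall>z\<in>EObj X.
        EFA A x z \<cdot>\<^bsub>W\<^esub> EComp X x y z
        = EComp Y (EFO A x) (EFO A y) (EFO A z) \<cdot>\<^bsub>W\<^esub> (EFA A y z \<otimes>\<^bsub>W\<^esub> EFA A x y))"

definition efun_id :: "('o, 'a) smcc \<Rightarrow> ('x, 'o, 'a) ecat \<Rightarrow> ('x, 'x, 'a) efun" where
  "efun_id W X = \<lparr>EFO = (\<lambda>x. x), EFA = (\<lambda>x y. Idn W (EHom X x y))\<rparr>"

definition efun_comp ::
  "('o, 'a) smcc \<Rightarrow> ('y, 'z, 'a) efun \<Rightarrow> ('x, 'y, 'a) efun \<Rightarrow> ('x, 'z, 'a) efun" where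
  "efun_comp W B A = \<lparr>EFO = (\<lambda>x. EFO B (EFO A x)),
     EFA = (\<lambda>x y. EFA B (EFO A x) (EFO A y) \<cdot>\<^bsub>W\<^esub> EFA A x y)\<rparr>"

definition ecompose ::
  "('o, 'a) smcc \<Rightarrow> ('x, 'o, 'a) ecat \<Rightarrow> 'x \<Rightarrow> 'x \<Rightarrow> 'x \<Rightarrow> 'a \<Rightarrow> 'a \<Rightarrow> 'a" where
  "ecompose W X x y z g f = EComp X x y z \<cdot>\<^bsub>W\<^esub> (g \<otimes>\<^bsub>W\<^esub> f) \<cdot>\<^bsub>W\<^esub> inv_arr W (lun W (unt W))"

text \<open>Arrows of the underlying category carry their domain and codomain.\<close>

definition underlying ::
  "('o, 'a) smcc \<Rightarrow> ('x, 'o, 'a) ecat \<Rightarrow> ('x, 'x \<times> 'a \<times> 'x) cat" where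
  "underlying W X = \<lparr>
     Obj = EObj X,
     Arr = {(x, f, y). x \<in> EObj X \<and> y \<in> EObj X \<and> f \<in> Hom W (unt W) (EHom X x y)},
     Dom = (\<lambda>(x, f, y). x),
     Cod = (\<lambda>(x, f, y). y),
     Idn = (\<lambda>x. (x, EId X x, x)),
     Comp = (\<lambda>(y', g, z) (x, f, y). (x, ecompose W X x y z g f, z))\<rparr>"

definition enriched_nat ::
  "('o, 'a) smcc \<Rightarrow> ('x, 'o, 'a) ecat \<Rightarrow> ('y, 'o, 'a) ecat
    \<Rightarrow> ('x, 'y, 'a) efun \<Rightarrow> ('x, 'y, 'a) efun \<Rightarrow> ('x \<Rightarrow> 'a) \<Rightarrow> bool" where
  "enriched_nat W X Y A B t \<longleftrightarrow>
     (\<forall>x\<in>EObj X. t x \<in> Hom W (unt W) (EHom Y (EFO A x) (EFO B x))) \<and>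
     (\<forall>x\<in>EObj X. \<forall>y\<in>EObj X.
        EComp Y (EFO A x) (EFO A y) (EFO B y)
          \<cdot>\<^bsub>W\<^esub> (t y \<otimes>\<^bsub>W\<^esub> EFA A x y) \<cdot>\<^bsub>W\<^esub> inv_arr W (lun W (EHom X x y))
        = EComp Y (EFO A x) (EFO B x) (EFO B y)
          \<cdot>\<^bsub>W\<^esub> (EFA B x y \<otimes>\<^bsub>W\<^esub> t x) \<cdot>\<^bsub>W\<^esub> inv_arr W (run W (EHom X x y)))"

definition enat_comp ::
  "('o, 'a) smcc \<Rightarrow> ('y, 'o, 'a) ecat
    \<Rightarrow> ('x, 'y, 'a) efun \<Rightarrow> ('x, 'y, 'a) efun \<Rightarrow> ('x, 'y, 'a) efun
    \<Rightarrow> ('x \<Rightarrow> 'a) \<Rightarrow> ('x \<Rightarrow> 'a) \<Rightarrow> ('x \<Rightarrow> 'a)" where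
  "enat_comp W Y A B C t s = (\<lambda>x. ecompose W Y (EFO A x) (EFO B x) (EFO C x) (t x) (s x))"

definition enat_iso ::
  "('o, 'a) smcc \<Rightarrow> ('x, 'o, 'a) ecat \<Rightarrow> ('y, 'o, 'a) ecat
    \<Rightarrow> ('x, 'y, 'a) efun \<Rightarrow> ('x, 'y, 'a) efun \<Rightarrow> ('x \<Rightarrow> 'a) \<Rightarrow> bool" where
  "enat_iso W X Y A B t \<longleftrightarrow>
     enriched_nat W X Y A B t \<and>
     (\<exists>s. enriched_nat W X Y B A s \<and>
        (\<forall>x\<in>EObj X. enat_comp W Y A B A s t x = EId Y (EFO A x) \<and>
                    enat_comp W Y B A B t s x = EId Y (EFO B x)))"

definition enriched_equivalent ::
  "('o, 'a) smcc \<Rightarrow> ('x, 'o, 'a) ecat \<Rightarrow> ('y, 'o, 'a) ecat \<Rightarrow> bool" where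
  "enriched_equivalent W X Y \<longleftrightarrow>
     (\<exists>A B. enriched_functor W X Y A \<and> enriched_functor W Y X B \<and>
        (\<exists>t. enat_iso W X X (efun_comp W B A) (efun_id W X) t) \<and>
        (\<exists>t. enat_iso W Y Y (efun_comp W A B) (efun_id W Y) t))"

definition small_enriched_category ::
  "'s itself \<Rightarrow> ('o, 'a) smcc \<Rightarrow> ('x, 'o, 'a) ecat \<Rightarrow> bool" where
  "small_enriched_category S W X \<longleftrightarrow>
     enriched_category W X \<and>
     (\<exists>D :: ('s, 'o, 'a) ecat. enriched_category W D \<and> small S (EObj D) \<and>
        enriched_equivalent W D X)"

definition op_ecat :: "('o, 'a) smcc \<Rightarrow> ('x, 'o, 'a) ecat \<Rightarrow> ('x, 'o, 'a) ecat" where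
  "op_ecat W X = \<lparr>EObj = EObj X, EHom = (\<lambda>x y. EHom X y x), EId = EId X,
     EComp = (\<lambda>x y z. EComp X z y x \<cdot>\<^bsub>W\<^esub> brd W (EHom X z y) (EHom X y x))\<rparr>"

definition self :: "('o, 'a) smcc \<Rightarrow> ('o, 'o, 'a) ecat" where
  "self W = \<lparr>EObj = Obj W, EHom = ihom W,
     EId = (\<lambda>x. curry W (unt W) x x (lun W x)),
     EComp = (\<lambda>x y z. curry W (ihom W y z \<odot>\<^bsub>W\<^esub> ihom W x y) x z
        (ev W y z \<cdot>\<^bsub>W\<^esub> (Idn W (ihom W y z) \<otimes>\<^bsub>W\<^esub> ev W x y)
          \<cdot>\<^bsub>W\<^esub> asc W (ihom W y z) (ihom W x y) x))\<rparr>"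

text \<open>The arrow of the underlying category of self W that corresponds to f : x --> y.\<close>

definition name_of :: "('o, 'a) smcc \<Rightarrow> 'o \<Rightarrow> 'o \<Rightarrow> 'a \<Rightarrow> 'a" where
  "name_of W x y f = curry W (unt W) x y (f \<cdot>\<^bsub>W\<^esub> lun W x)"

text \<open>For e : unt W --> X(a,b), precomposition goes from X(b,c) to X(a,c); for e : unt W --> X(b,c),
  postcomposition goes from X(a,b) to X(a,c).\<close>

definition precomp ::
  "('o, 'a) smcc \<Rightarrow> ('x, 'o, 'a) ecat \<Rightarrow> 'x \<Rightarrow> 'x \<Rightarrow> 'x \<Rightarrow> 'a \<Rightarrow> 'a" where
  "precomp W X a b c e =
     EComp X a b c \<cdot>\<^bsub>W\<^esub> (Idn W (EHom X b c) \<otimes>\<^bsub>W\<^esub> e) \<cdot>\<^bsub>W\<^esub> inv_arr W (run W (EHom X b c))"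

definition postcomp ::
  "('o, 'a) smcc \<Rightarrow> ('x, 'o, 'a) ecat \<Rightarrow> 'x \<Rightarrow> 'x \<Rightarrow> 'x \<Rightarrow> 'a \<Rightarrow> 'a" where
  "postcomp W X a b c e =
     EComp X a b c \<cdot>\<^bsub>W\<^esub> (e \<otimes>\<^bsub>W\<^esub> Idn W (EHom X a b)) \<cdot>\<^bsub>W\<^esub> inv_arr W (lun W (EHom X a b))"

text \<open>A conical limit of D is a cone in the underlying category that every representable X(a, -)
  sends to a limit cone in W; a conical colimit is a cocone that every X(-, a) sends to a limit
  cone in W.\<close>

definition is_conical_limit ::
  "('o, 'a) smcc \<Rightarrow> ('x, 'o, 'a) ecat \<Rightarrow> ('j, 'i, 'n) cat_scheme
    \<Rightarrow> ('j, 'i, 'x, 'x \<times> 'a \<times> 'x) ftor \<Rightarrow> 'x \<Rightarrow> ('j \<Rightarrow> 'x \<times> 'a \<times> 'x) \<Rightarrow> bool" where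
  "is_conical_limit W X J D L l \<longleftrightarrow>
     is_cone (underlying W X) J D L l \<and>
     (\<forall>a\<in>EObj X.
        let post = (\<lambda>(b, e, c). postcomp W X a b c e) in
        is_limit W J \<lparr>FO = (\<lambda>j. EHom X a (FO D j)), FA = (\<lambda>f. post (FA D f))\<rparr>
          (EHom X a L) (\<lambda>j. post (l j)))"

definition is_conical_colimit ::
  "('o, 'a) smcc \<Rightarrow> ('x, 'o, 'a) ecat \<Rightarrow> ('j, 'i, 'n) cat_scheme
    \<Rightarrow> ('j, 'i, 'x, 'x \<times> 'a \<times> 'x) ftor \<Rightarrow> 'x \<Rightarrow> ('j \<Rightarrow> 'x \<times> 'a \<times> 'x) \<Rightarrow> bool" where
  "is_conical_colimit W X J D L l \<longleftrightarrow>
     is_cone (op_cat (underlying W X)) (op_cat J) D L l \<and>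
     (\<forall>a\<in>EObj X.
        let pre = (\<lambda>(b, e, c). precomp W X b c a e) in
        is_limit W (op_cat J) \<lparr>FO = (\<lambda>j. EHom X (FO D j) a), FA = (\<lambda>f. pre (FA D f))\<rparr>
          (EHom X L a) (\<lambda>j. pre (l j)))"

definition has_small_conical_limits_colimits ::
  "'s itself \<Rightarrow> ('o, 'a) smcc \<Rightarrow> ('x, 'o, 'a) ecat \<Rightarrow> bool" where
  "has_small_conical_limits_colimits S W X \<longleftrightarrow>
     (\<forall>(J :: ('s, 's) cat) (D :: ('s, 's, 'x, 'x \<times> 'a \<times> 'x) ftor).
        small_category S J \<and> is_functor J (underlying W X) D \<longrightarrow>
        (\<exists>L l. is_conical_limit W X J D L l) \<and> (\<exists>L l. is_conical_colimit W X J D L l))"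

definition base_of_enrichment :: "'s itself \<Rightarrow> ('o, 'a) smcc \<Rightarrow> bool" where
  "base_of_enrichment S W \<longleftrightarrow>
     symmetric_monoidal_closed W \<and>
     locally_finitely_presentable S W \<and>
     locally_small S W \<and>
     has_small_conical_limits_colimits S W (self W) \<and>
     (\<forall>xs. (\<forall>x\<in>set xs. finitely_presentable S W x) \<longrightarrow>
        finitely_presentable S W (foldr (tens W) xs (unt W))) \<and>
     regular_category W"


section \<open>Base change\<close>

definition base_change_cat ::
  "('u, 'g) smcc \<Rightarrow> ('v, 'f, 'u, 'g) lax \<Rightarrow> ('x, 'v, 'f) ecat \<Rightarrow> ('x, 'u, 'g) ecat" where
  "base_change_cat U G X = \<lparr>EObj = EObj X,
     EHom = (\<lambda>x y. FO G (EHom X x y)),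
     EId = (\<lambda>x. FA G (EId X x) \<cdot>\<^bsub>U\<^esub> lu G),
     EComp = (\<lambda>x y z. FA G (EComp X x y z) \<cdot>\<^bsub>U\<^esub> lm G (EHom X y z) (EHom X x y))\<rparr>"

definition base_change_fun ::
  "('v, 'f, 'u, 'g) lax \<Rightarrow> ('x, 'y, 'f) efun \<Rightarrow> ('x, 'y, 'g) efun" where
  "base_change_fun G A = \<lparr>EFO = EFO A, EFA = (\<lambda>x y. FA G (EFA A x y))\<rparr>"

definition kmap :: "('u, 'g) smcc \<Rightarrow> ('v, 'f, 'u, 'g) lax \<Rightarrow> 'f \<Rightarrow> 'g" where
  "kmap U G f = FA G f \<cdot>\<^bsub>U\<^esub> lu G"

text \<open>The hom-object isomorphism G V(Fx, y) --> U(x, G y) of the induced U-adjunction, which by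
  Yoneda corresponds to the natural bijections
  U(z, G V(Fx, y)) = V(F z (.) F x, y) = V(F (z (.) x), y) = U(z, U(x, G y)).
  The image of the identity of z = G V(Fx, y) is the transpose of
  G V(Fx, y) (.) x --> G V(Fx, y) (.) G F x --> G (V(Fx, y) (.) F x) --> G y.\<close>

definition Phi ::
  "('u, 'g) smcc \<Rightarrow> ('v, 'f) smcc \<Rightarrow> ('u, 'g, 'v, 'f) lax \<Rightarrow> ('v, 'f, 'u, 'g) lax
    \<Rightarrow> ('u \<Rightarrow> 'g) \<Rightarrow> 'u \<Rightarrow> 'v \<Rightarrow> 'g" where
  "Phi U V F G eta x y =
     curry U (FO G (ihom V (FO F x) y)) x (FO G y)
       (FA G (ev V (FO F x) y) \<cdot>\<^bsub>U\<^esub> lm G (ihom V (FO F x) y) (FO F x)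
         \<cdot>\<^bsub>U\<^esub> (Idn U (FO G (ihom V (FO F x) y)) \<otimes>\<^bsub>U\<^esub> eta x))"

definition GU ::
  "('u, 'g) smcc \<Rightarrow> ('v, 'f) smcc \<Rightarrow> ('u, 'g, 'v, 'f) lax \<Rightarrow> ('v, 'f, 'u, 'g) lax
    \<Rightarrow> ('u \<Rightarrow> 'g) \<Rightarrow> ('v \<Rightarrow> 'f) \<Rightarrow> ('v, 'u, 'g) efun" where
  "GU U V F G eta eps = \<lparr>EFO = FO G,
     EFA = (\<lambda>x y. Phi U V F G eta (FO G x) y \<cdot>\<^bsub>U\<^esub>
       precomp U (base_change_cat U G (self V)) (FO F (FO G x)) x y
         (kmap U G (name_of V (FO F (FO G x)) x (eps x))))\<rparr>"

definition Gtilde ::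
  "('u, 'g) smcc \<Rightarrow> ('v, 'f) smcc \<Rightarrow> ('u, 'g, 'v, 'f) lax \<Rightarrow> ('v, 'f, 'u, 'g) lax
    \<Rightarrow> ('u \<Rightarrow> 'g) \<Rightarrow> ('v \<Rightarrow> 'f) \<Rightarrow> ('x, 'v, 'f) efun \<Rightarrow> ('x, 'u, 'g) efun" where
  "Gtilde U V F G eta eps R = efun_comp U (GU U V F G eta eps) (base_change_fun G R)"

definition Gtilde_nat ::
  "('u, 'g) smcc \<Rightarrow> ('v, 'f) smcc \<Rightarrow> ('u, 'g, 'v, 'f) lax \<Rightarrow> ('v, 'f, 'u, 'g) lax
    \<Rightarrow> ('u \<Rightarrow> 'g) \<Rightarrow> ('v \<Rightarrow> 'f) \<Rightarrow> ('x, 'v, 'f) efun \<Rightarrow> ('x, 'v, 'f) efun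
    \<Rightarrow> ('x \<Rightarrow> 'f) \<Rightarrow> ('x \<Rightarrow> 'g)" where
  "Gtilde_nat U V F G eta eps A B t =
     (\<lambda>x. EFA (GU U V F G eta eps) (EFO A x) (EFO B x) \<cdot>\<^bsub>U\<^esub> kmap U G (t x))"


section \<open>Subobjects of enriched functors\<close>

text \<open>A monomorphism with codomain K is a pair of its domain and its family of components; equality
  of natural transformations is equality of components at the objects of X.\<close>

type_synonym ('x, 'o, 'a) subfun = "('x, 'o, 'a) efun \<times> ('x \<Rightarrow> 'a)"

definition Monos ::
  "('o, 'a) smcc \<Rightarrow> ('x, 'o, 'a) ecat \<Rightarrow> ('x, 'o, 'a) efun \<Rightarrow> ('x, 'o, 'a) subfun set" where
  "Monos W X K = {(A, r). enriched_functor W X (self W) A \<and> enriched_functor W X (self W) K \<and>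
     enriched_nat W X (self W) A K r \<and>
     (\<forall>x\<in>EObj X. monic (underlying W (self W)) (EFO A x, r x, EFO K x))}"

definition mono_ge ::
  "('o, 'a) smcc \<Rightarrow> ('x, 'o, 'a) ecat \<Rightarrow> ('x, 'o, 'a) efun
    \<Rightarrow> ('x, 'o, 'a) subfun \<Rightarrow> ('x, 'o, 'a) subfun \<Rightarrow> bool" where
  "mono_ge W X K = (\<lambda>(A, r) (B, s).
     \<exists>t. enriched_nat W X (self W) B A t \<and>
         (\<forall>x\<in>EObj X. s x = enat_comp W (self W) B A K r t x))"

definition mono_equiv ::
  "('o, 'a) smcc \<Rightarrow> ('x, 'o, 'a) ecat \<Rightarrow> ('x, 'o, 'a) efun
    \<Rightarrow> (('x, 'o, 'a) subfun \<times> ('x, 'o, 'a) subfun) set" where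
  "mono_equiv W X K = {((A, r), (B, s)). (A, r) \<in> Monos W X K \<and> (B, s) \<in> Monos W X K \<and>
     (\<exists>t. enat_iso W X (self W) A B t \<and>
          (\<forall>x\<in>EObj X. r x = enat_comp W (self W) A B K s t x))}"

definition Sub ::
  "('o, 'a) smcc \<Rightarrow> ('x, 'o, 'a) ecat \<Rightarrow> ('x, 'o, 'a) efun \<Rightarrow> ('x, 'o, 'a) subfun set set" where
  "Sub W X K = Monos W X K // mono_equiv W X K"

definition sub_class ::
  "('o, 'a) smcc \<Rightarrow> ('x, 'o, 'a) ecat \<Rightarrow> ('x, 'o, 'a) efun
    \<Rightarrow> ('x, 'o, 'a) subfun \<Rightarrow> ('x, 'o, 'a) subfun set" where
  "sub_class W X K r = mono_equiv W X K `` {r}"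

definition Sub_order ::
  "('o, 'a) smcc \<Rightarrow> ('x, 'o, 'a) ecat \<Rightarrow> ('x, 'o, 'a) efun
    \<Rightarrow> (('x, 'o, 'a) subfun set \<times> ('x, 'o, 'a) subfun set) set" where
  "Sub_order W X K = {(P, Q). P \<in> Sub W X K \<and> Q \<in> Sub W X K \<and>
     (\<exists>r\<in>P. \<exists>s\<in>Q. mono_ge W X K s r)}"

definition poset_morphism ::
  "'p set \<Rightarrow> 'p rel \<Rightarrow> 'q set \<Rightarrow> 'q rel \<Rightarrow> ('p \<Rightarrow> 'q) \<Rightarrow> bool" where
  "poset_morphism P le Q le' f \<longleftrightarrow>
     partial_order_on P le \<and> partial_order_on Q le' \<and> f \<in> P \<rightarrow> Q \<and>
     (\<forall>a\<in>P. \<forall>b\<in>P. (a, b) \<in> le \<longrightarrow> (f a, f b) \<in> le')"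

end

theory Submission
  imports Defs
begin

text \<open>The claim reduces to one statement about preorders: on monomorphisms into \<open>K\<close>, the
  assignment \<open>r \<mapsto> Gtilde r\<close> both preserves and reflects the relation "factors through".  Such an
  assignment between preorders descends to an injective monotone map between the quotient posets
  (\<open>order_embedding_descends_to_quotients\<close>), and \<open>Sub(K)\<close> is the quotient poset of the monomorphisms
  into \<open>K\<close>, because two monomorphisms that factor through each other differ by an isomorphism
  (\<open>mono_equiv_iff\<close>).

  Factorization is a pointwise matter in the underlying category (\<open>mono_ge_iff\<close>).  Write an
  enriched functor \<open>A\<close> into the base as objects \<open>A x\<close> with actions \<open>X(x,y) \<odot> A x \<rightarrow> A y\<close>, obtained
  by uncurrying, and a natural transformation as a family of arrows \<open>A x \<rightarrow> B x\<close> that commutes with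
  the actions (\<open>enriched_functor_self_iff\<close>, \<open>enriched_nat_self_iff\<close>).  If a monomorphism \<open>r\<close> and a
  natural \<open>s\<close> are given and every component of \<open>s\<close> factors through that of \<open>r\<close>, then the factors
  are automatically natural, since \<open>r\<close> can be cancelled from the naturality square.

  In this description \<open>Gtilde\<close> is transparent.  The triangle identities collapse the hom-arrow of
  \<open>G\<^sup>U\<close> to the transpose of \<open>G(ev) \<cdot> m\<close> (\<open>uncurry_GU\<close>); hence \<open>Gtilde A\<close> has action \<open>G(act) \<cdot> m\<close>
  and the component of \<open>Gtilde t\<close> at \<open>x\<close> is \<open>G\<close> of the component of \<open>t\<close> (\<open>action_Gtilde\<close>,
  \<open>component_Gtilde_nat\<close>).  So it remains to see that \<open>G\<close> preserves and reflects factorizations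
  through a monomorphism.  Preservation is functoriality.  For reflection
  (\<open>G_reflects_factorization\<close>) let \<open>s\<close> be a monomorphism and \<open>G r = G s \<cdot> u\<close>, and let \<open>p\<close> be the
  pullback of \<open>s\<close> along \<open>r\<close>.  Then \<open>G p\<close> is a monomorphism, as \<open>G\<close> is a right adjoint, and \<open>u\<close>
  provides a section of it, so \<open>G p\<close> is an isomorphism.  By conservativity \<open>p\<close> is one, and
  \<open>r\<close> factors through \<open>s\<close>.\<close>

section \<open>Quotients of preorders\<close>

locale preordered_set =
  fixes M :: "'p set" and ge :: "'p \<Rightarrow> 'p \<Rightarrow> bool"
  assumes refl: "a \<in> M \<Longrightarrow> ge a a"
    and trans: "\<lbrakk>a \<in> M; b \<in> M; c \<in> M; ge a b; ge b c\<rbrakk> \<Longrightarrow> ge a c"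
begin

definition eqv :: "'p rel" where
  "eqv = {(a, b). a \<in> M \<and> b \<in> M \<and> ge a b \<and> ge b a}"

text \<open>The relation \<open>ge\<close> has the larger element on the left, the order on classes has it on the right;
  hence \<open>r\<close> and \<open>s\<close> change places.\<close>

definition quotient_order :: "'p set rel" where
  "quotient_order = {(P, Q). P \<in> M // eqv \<and> Q \<in> M // eqv \<and> (\<exists>r\<in>P. \<exists>s\<in>Q. ge s r)}"

lemma equiv_eqv: "equiv M eqv"
  unfolding eqv_def by (rule equivI) (auto simp: refl_on_def sym_def trans_def intro: refl trans)

lemma eqv_class_in_quotient_order:
  assumes "a \<in> M" "b \<in> M"
  shows "(eqv `` {b}, eqv `` {a}) \<in> quotient_order \<longleftrightarrow> ge a b"
proof
  have mem: "y \<in> eqv `` {x} \<longleftrightarrow> x \<in> M \<and> y \<in> M \<and> ge x y \<and> ge y x" for x y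
    unfolding eqv_def by blast
  {
    assume "(eqv `` {b}, eqv `` {a}) \<in> quotient_order"
    then obtain r s where "r \<in> eqv `` {b}" "s \<in> eqv `` {a}" "ge s r"
      unfolding quotient_order_def by blast
    then show "ge a b" using assms mem trans by meson
  next
    assume "ge a b"
    moreover have "a \<in> eqv `` {a}" "b \<in> eqv `` {b}" using assms mem refl by auto
    ultimately show "(eqv `` {b}, eqv `` {a}) \<in> quotient_order"
      unfolding quotient_order_def using assms by (auto intro: quotientI)
  }
qed

lemma partial_order_quotient: "partial_order_on (M // eqv) quotient_order"
  unfolding partial_order_on_def preorder_on_def
proof (intro conjI)
  have Obj: "P \<in> M // eqv \<and> Q \<in> M // eqv" if "(P, Q) \<in> quotient_order" for P Q
    using that by (auto simp: quotient_order_def)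
  note le = eqv_class_in_quotient_order
  show "quotient_order \<subseteq> (M // eqv) \<times> (M // eqv)" unfolding quotient_order_def by blast
  show "refl_on (M // eqv) quotient_order"
    by (rule refl_onI) (metis le quotientE refl)
  show "trans quotient_order"
  proof (rule transI)
    fix P Q R assume PQR: "(P, Q) \<in> quotient_order" "(Q, R) \<in> quotient_order"
    then obtain a b c where abc: "a \<in> M" "b \<in> M" "c \<in> M"
      "P = eqv `` {a}" "Q = eqv `` {b}" "R = eqv `` {c}"
      by (meson Obj quotientE)
    then show "(P, R) \<in> quotient_order" using PQR le trans[of c b a] by simp
  qed
  show "antisym quotient_order"
  proof (rule antisymI)
    fix P Q assume PQ: "(P, Q) \<in> quotient_order" "(Q, P) \<in> quotient_order"
    then obtain a b where "a \<in> M" "b \<in> M" "P = eqv `` {a}" "Q = eqv `` {b}"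
      by (meson Obj quotientE)
    then show "P = Q"
      using PQ le equiv_class_eq[OF equiv_eqv, of a b] by (auto simp: eqv_def)
  qed
qed

end

text \<open>Injectivity comes from reflection of the preorder: if \<open>g a\<close> and \<open>g b\<close> lie below each other, then
  so do \<open>a\<close> and \<open>b\<close>, which means that their classes coincide.\<close>

lemma order_embedding_descends_to_quotients:
  assumes "preordered_set M ge" and "preordered_set N ge'"
    and g_in: "\<And>a. a \<in> M \<Longrightarrow> g a \<in> N"
    and g_ge: "\<And>a b. \<lbrakk>a \<in> M; b \<in> M\<rbrakk> \<Longrightarrow> ge' (g a) (g b) \<longleftrightarrow> ge a b"
  defines "E \<equiv> preordered_set.eqv M ge" and "E' \<equiv> preordered_set.eqv N ge'"
  shows "\<exists>h. (\<forall>a\<in>M. h (E `` {a}) = E' `` {g a}) \<and>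
    poset_morphism (M // E) (preordered_set.quotient_order M ge)
      (N // E') (preordered_set.quotient_order N ge') h \<and> inj_on h (M // E)"
proof -
  interpret M: preordered_set M ge by fact
  interpret N: preordered_set N ge' by fact
  \<comment> \<open>Saturating the image of a class under \<open>E'\<close> avoids choosing a representative.\<close>
  define h where "h = (\<lambda>P. E' `` (g ` P))"
  have h: "h (E `` {a}) = E' `` {g a}" if "a \<in> M" for a
  proof -
    have "E' `` {g b} = E' `` {g a}" if "b \<in> E `` {a}" for b
      unfolding E'_def
    proof (rule equiv_class_eq[OF N.equiv_eqv])
      show "(g b, g a) \<in> N.eqv" using that g_in g_ge unfolding E_def M.eqv_def N.eqv_def by auto
    qed
    moreover have "a \<in> E `` {a}" unfolding E_def using equiv_class_self[OF M.equiv_eqv that] .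
    ultimately have "(\<Union>b\<in>E `` {a}. E' `` {g b}) = E' `` {g a}" by blast
    then show ?thesis unfolding h_def by blast
  qed
  have "poset_morphism (M // E) M.quotient_order (N // E') N.quotient_order h"
    unfolding poset_morphism_def
  proof (intro conjI ballI impI Pi_I)
    show "partial_order_on (M // E) M.quotient_order" "partial_order_on (N // E') N.quotient_order"
      unfolding E_def E'_def by (fact M.partial_order_quotient N.partial_order_quotient)+
    fix P assume "P \<in> M // E"
    then show "h P \<in> N // E'" using h g_in by (metis quotientE quotientI)
  next
    fix P Q assume "P \<in> M // E" "Q \<in> M // E" and PQ: "(P, Q) \<in> M.quotient_order"
    then obtain a b where ab: "a \<in> M" "b \<in> M" "P = E `` {a}" "Q = E `` {b}" by (meson quotientE)
    then have "ge b a" using PQ M.eqv_class_in_quotient_order unfolding E_def by simp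
    then show "(h P, h Q) \<in> N.quotient_order"
      using ab h N.eqv_class_in_quotient_order g_in g_ge unfolding E'_def by simp
  qed
  moreover have "inj_on h (M // E)"
  proof (rule inj_onI)
    fix P Q assume "P \<in> M // E" "Q \<in> M // E" and hh: "h P = h Q"
    then obtain a b where ab: "a \<in> M" "b \<in> M" "P = E `` {a}" "Q = E `` {b}" by (meson quotientE)
    then have "(g a, g b) \<in> N.eqv"
      using hh h g_in eq_equiv_class[OF _ N.equiv_eqv] unfolding E'_def by simp
    then have "(a, b) \<in> M.eqv" using ab g_ge unfolding M.eqv_def N.eqv_def by simp
    then show "P = Q" unfolding ab E_def by (rule equiv_class_eq[OF M.equiv_eqv])
  qed
  ultimately show ?thesis using h by blast
qed

section \<open>Isomorphisms, monomorphisms and pullbacks\<close>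

lemma in_Hom: "f \<in> Hom C x y \<longleftrightarrow> f \<in> Arr C \<and> Dom C f = x \<and> Cod C f = y"
  by (auto simp: Hom_def)

context category
begin

text \<open>The axioms speak of hom-sets with named domain and codomain, which the simplifier would have to
  guess when it checks a side condition.  Stated through \<open>Dom\<close> and \<open>Cod\<close> they are rewrite
  rules that check typing by computation.\<close>

lemma Obj_Dom [simp]: "f \<in> Arr C \<Longrightarrow> Dom C f \<in> Obj C"
  and Obj_Cod [simp]: "f \<in> Arr C \<Longrightarrow> Cod C f \<in> Obj C"
  by (simp_all add: Dom_in Cod_in)

lemma Idn_Arr [simp]: "x \<in> Obj C \<Longrightarrow> Idn C x \<in> Arr C"
  and Dom_Idn [simp]: "x \<in> Obj C \<Longrightarrow> Dom C (Idn C x) = x"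
  and Cod_Idn [simp]: "x \<in> Obj C \<Longrightarrow> Cod C (Idn C x) = x"
  using Idn_in[of x] by (simp_all add: in_Hom)

lemma
  assumes "f \<in> Arr C" "g \<in> Arr C" "Dom C g = Cod C f"
  shows Comp_Arr [simp]: "g \<cdot> f \<in> Arr C"
    and Dom_Comp [simp]: "Dom C (g \<cdot> f) = Dom C f"
    and Cod_Comp [simp]: "Cod C (g \<cdot> f) = Cod C g"
  using Comp_in[of f "Dom C f" "Cod C f" g "Cod C g"] assms by (simp_all add: in_Hom)

lemma Comp_Idn_simp [simp]: "\<lbrakk>f \<in> Arr C; x = Dom C f\<rbrakk> \<Longrightarrow> f \<cdot> Idn C x = f"
  and Idn_Comp_simp [simp]: "\<lbrakk>f \<in> Arr C; x = Cod C f\<rbrakk> \<Longrightarrow> Idn C x \<cdot> f = f"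
  by (auto intro: Comp_Idn Idn_Comp simp: in_Hom)

lemma assoc [simp]:
  "\<lbrakk>f \<in> Arr C; g \<in> Arr C; h \<in> Arr C; Dom C g = Cod C f; Dom C h = Cod C g\<rbrakk>
    \<Longrightarrow> (h \<cdot> g) \<cdot> f = h \<cdot> (g \<cdot> f)"
  by (rule Comp_assoc) (auto simp: in_Hom)

lemma Comp_cong_left:
  "\<lbrakk>g \<cdot> f = g' \<cdot> f'; f \<in> Arr C; g \<in> Arr C; Dom C g = Cod C f;
    f' \<in> Arr C; g' \<in> Arr C; Dom C g' = Cod C f'; e \<in> Arr C; Cod C e = Dom C f\<rbrakk>
    \<Longrightarrow> g \<cdot> (f \<cdot> e) = g' \<cdot> (f' \<cdot> e)"
  by (metis Dom_Comp assoc)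

lemma inverse_arrows_unique:
  assumes "inverse_arrows C f g" "inverse_arrows C f h"
  shows "g = h"
proof -
  have t: "f \<in> Arr C" "g \<in> Arr C" "h \<in> Arr C" "Dom C g = Cod C f" "Cod C g = Dom C f"
    "Dom C h = Cod C f" "Cod C h = Dom C f"
    and e: "f \<cdot> g = Idn C (Cod C f)" "h \<cdot> f = Idn C (Dom C f)"
    using assms by (auto simp: inverse_arrows_def in_Hom)
  have "h \<cdot> (f \<cdot> g) = (h \<cdot> f) \<cdot> g" using t by simp
  then show ?thesis using t unfolding e by simp
qed

lemma inverse_arrows_inv_arr:
  assumes "is_iso C f" shows "inverse_arrows C f (inv_arr C f)"
  unfolding inv_arr_def
  using assms inverse_arrows_unique unfolding is_iso_def by (metis (mono_tags, lifting) theI')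

lemma
  assumes "is_iso C f"
  shows inv_Arr [simp]: "inv_arr C f \<in> Arr C"
    and Dom_inv [simp]: "Dom C (inv_arr C f) = Cod C f"
    and Cod_inv [simp]: "Cod C (inv_arr C f) = Dom C f"
    and iso_inv [simp]: "f \<cdot> inv_arr C f = Idn C (Cod C f)"
    and inv_iso [simp]: "inv_arr C f \<cdot> f = Idn C (Dom C f)"
    and iso_Arr: "f \<in> Arr C"
  using inverse_arrows_inv_arr[OF assms] by (simp_all add: inverse_arrows_def in_Hom)

lemma
  assumes "is_iso C f" "e \<in> Arr C"
  shows iso_inv_cancel [simp]: "Cod C e = Cod C f \<Longrightarrow> f \<cdot> (inv_arr C f \<cdot> e) = e"
    and inv_iso_cancel [simp]: "Cod C e = Dom C f \<Longrightarrow> inv_arr C f \<cdot> (f \<cdot> e) = e"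
  using assms iso_Arr[OF assms(1)]
  by (simp_all del: assoc add: assoc[symmetric])

lemma iso_cancel_right:
  assumes "is_iso C e" "g \<in> Arr C" "h \<in> Arr C" "Dom C g = Cod C e" "Dom C h = Cod C e"
    "g \<cdot> e = h \<cdot> e"
  shows "g = h"
proof -
  have "k \<cdot> e \<cdot> inv_arr C e = k" if "k \<in> Arr C" "Dom C k = Cod C e" for k
    using that assms(1) iso_Arr[OF assms(1)] by simp
  then show ?thesis using assms(2-6) by metis
qed

lemma is_isoI:
  assumes "f \<in> Arr C" "g \<in> Arr C" "Dom C g = Cod C f" "Cod C g = Dom C f"
    "g \<cdot> f = Idn C (Dom C f)" "f \<cdot> g = Idn C (Cod C f)"
  shows "is_iso C f"
  unfolding is_iso_def inverse_arrows_def using assms by (auto simp: in_Hom)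

lemma monicD:
  assumes "monic C f" "g \<in> Arr C" "h \<in> Arr C" "Dom C g = Dom C h"
    "Cod C g = Dom C f" "Cod C h = Dom C f" "f \<cdot> g = f \<cdot> h"
  shows "g = h"
proof -
  have "Dom C g \<in> Obj C" "g \<in> Hom C (Dom C g) (Dom C f)" "h \<in> Hom C (Dom C g) (Dom C f)"
    using assms by (auto simp: in_Hom)
  then show ?thesis using assms(1,7) unfolding monic_def by blast
qed

lemma monicI:
  assumes "f \<in> Arr C"
    and "\<And>g h. \<lbrakk>g \<in> Arr C; h \<in> Arr C; Dom C g = Dom C h; Cod C g = Dom C f; Cod C h = Dom C f;
      f \<cdot> g = f \<cdot> h\<rbrakk> \<Longrightarrow> g = h"
  shows "monic C f"
  unfolding monic_def
proof (intro conjI ballI impI)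
  fix w g h assume "g \<in> Hom C w (Dom C f)" "h \<in> Hom C w (Dom C f)" "f \<cdot> g = f \<cdot> h"
  then show "g = h" by - (rule assms(2), auto simp: in_Hom)
qed fact

lemma pullback_universal:
  assumes "is_pullback C f g p q" "a \<in> Arr C" "b \<in> Arr C" "Dom C a = Dom C b"
    "Cod C a = Dom C f" "Cod C b = Dom C g" "f \<cdot> a = g \<cdot> b"
  shows "\<exists>!h. h \<in> Hom C (Dom C a) (Dom C p) \<and> p \<cdot> h = a \<and> q \<cdot> h = b"
proof -
  have "Dom C a \<in> Obj C" "a \<in> Hom C (Dom C a) (Dom C f)" "b \<in> Hom C (Dom C a) (Dom C g)"
    using assms by (auto simp: in_Hom)
  then show ?thesis using assms(1,7) unfolding is_pullback_def by blast
qed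

lemma monic_split_epi_is_iso:
  assumes "monic C f" "h \<in> Arr C" "Dom C h = Cod C f" "Cod C h = Dom C f"
    "f \<cdot> h = Idn C (Cod C f)"
  shows "is_iso C f"
proof (rule is_isoI)
  show f: "f \<in> Arr C" using assms(1) by (simp add: monic_def)
  have "f \<cdot> (h \<cdot> f) = (f \<cdot> h) \<cdot> f" using f assms(2-4) by simp
  then have "f \<cdot> (h \<cdot> f) = f \<cdot> Idn C (Dom C f)" using f assms(5) by simp
  then show "h \<cdot> f = Idn C (Dom C f)"
    using monicD[OF assms(1), of "h \<cdot> f" "Idn C (Dom C f)"] f assms by simp
qed (use assms in auto)

text \<open>Arrows into a pullback are determined by their two projections; when \<open>g\<close> is monic, the projection
  along \<open>p\<close> determines the one along \<open>q\<close>, since \<open>g \<cdot> q = f \<cdot> p\<close>.\<close>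

lemma pullback_of_monic_is_monic:
  assumes pb: "is_pullback C f g p q" and "monic C g"
  shows "monic C p"
proof (rule monicI)
  have t: "f \<in> Arr C" "g \<in> Arr C" "p \<in> Arr C" "q \<in> Arr C" "Cod C f = Cod C g"
    "Cod C p = Dom C f" "Dom C q = Dom C p" "Cod C q = Dom C g" and e: "f \<cdot> p = g \<cdot> q"
    using pb by (auto simp: is_pullback_def in_Hom)
  show "p \<in> Arr C" by fact
  fix a b assume ab: "a \<in> Arr C" "b \<in> Arr C" "Dom C a = Dom C b" "Cod C a = Dom C p"
    "Cod C b = Dom C p" and pab: "p \<cdot> a = p \<cdot> b"
  have e': "f \<cdot> (p \<cdot> c) = g \<cdot> (q \<cdot> c)" if "c \<in> Arr C" "Cod C c = Dom C p" for c
    using Comp_cong_left[OF e] that t by simp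
  have "g \<cdot> (q \<cdot> a) = g \<cdot> (q \<cdot> b)" using e' pab ab by metis
  then have qab: "q \<cdot> a = q \<cdot> b" using monicD[OF assms(2)] t ab by simp
  have "f \<cdot> (p \<cdot> a) = g \<cdot> (q \<cdot> a)" using e' ab by simp
  then have "\<exists>!h. h \<in> Hom C (Dom C a) (Dom C p) \<and> p \<cdot> h = p \<cdot> a \<and> q \<cdot> h = q \<cdot> a"
    using pullback_universal[OF pb, of "p \<cdot> a" "q \<cdot> a"] t ab by simp
  moreover have "a \<in> Hom C (Dom C a) (Dom C p)" "b \<in> Hom C (Dom C a) (Dom C p)"
    using ab by (auto simp: in_Hom)
  ultimately show "a = b" using pab qab by (metis (no_types))
qed

end

section \<open>Closed monoidal structure\<close>

context symmetric_monoidal_closed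
begin

lemma tens_Obj [simp]: "\<lbrakk>x \<in> Obj W; y \<in> Obj W\<rbrakk> \<Longrightarrow> x \<odot> y \<in> Obj W"
  and unt_Obj [simp]: "unt W \<in> Obj W"
  and ihom_Obj [simp]: "\<lbrakk>x \<in> Obj W; y \<in> Obj W\<rbrakk> \<Longrightarrow> ihom W x y \<in> Obj W"
  by (simp_all add: tens_in unt_in ihom_in)

lemma
  assumes "f \<in> Arr W" "g \<in> Arr W"
  shows tensA_Arr [simp]: "f \<otimes> g \<in> Arr W"
    and Dom_tensA [simp]: "Dom W (f \<otimes> g) = Dom W f \<odot> Dom W g"
    and Cod_tensA [simp]: "Cod W (f \<otimes> g) = Cod W f \<odot> Cod W g"
  using tensA_in[of f "Dom W f" "Cod W f" g "Dom W g" "Cod W g"] assms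
  by (simp_all add: in_Hom)

declare tensA_Idn [simp]

lemma interchange [simp]:
  "\<lbrakk>f \<in> Arr W; f' \<in> Arr W; g \<in> Arr W; g' \<in> Arr W; Dom W f' = Cod W f; Dom W g' = Cod W g\<rbrakk>
    \<Longrightarrow> (f' \<otimes> g') \<cdot> (f \<otimes> g) = (f' \<cdot> f) \<otimes> (g' \<cdot> g)"
  by (rule tensA_Comp[symmetric]) (auto simp: in_Hom)

lemma interchange_cancel [simp]:
  "\<lbrakk>f \<in> Arr W; f' \<in> Arr W; g \<in> Arr W; g' \<in> Arr W; Dom W f' = Cod W f; Dom W g' = Cod W g;
    e \<in> Arr W; Cod W e = Dom W f \<odot> Dom W g\<rbrakk>
    \<Longrightarrow> (f' \<otimes> g') \<cdot> ((f \<otimes> g) \<cdot> e) = ((f' \<cdot> f) \<otimes> (g' \<cdot> g)) \<cdot> e"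
  by (simp del: assoc add: assoc[symmetric])

lemma
  assumes "x \<in> Obj W" "y \<in> Obj W" "z \<in> Obj W"
  shows asc_Arr [simp]: "asc W x y z \<in> Arr W"
    and Dom_asc [simp]: "Dom W (asc W x y z) = (x \<odot> y) \<odot> z"
    and Cod_asc [simp]: "Cod W (asc W x y z) = x \<odot> (y \<odot> z)"
    and asc_iso [simp]: "is_iso W (asc W x y z)"
  using asc_in[OF assms] by (simp_all add: in_Hom)

lemma
  assumes "x \<in> Obj W"
  shows lun_Arr [simp]: "lun W x \<in> Arr W"
    and Dom_lun [simp]: "Dom W (lun W x) = unt W \<odot> x"
    and Cod_lun [simp]: "Cod W (lun W x) = x"
    and lun_iso [simp]: "is_iso W (lun W x)"
    and run_Arr [simp]: "run W x \<in> Arr W"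
    and Dom_run [simp]: "Dom W (run W x) = x \<odot> unt W"
    and Cod_run [simp]: "Cod W (run W x) = x"
    and run_iso [simp]: "is_iso W (run W x)"
  using lun_in[OF assms] run_in[OF assms] by (simp_all add: in_Hom)

lemma
  assumes "x \<in> Obj W" "y \<in> Obj W"
  shows brd_Arr [simp]: "brd W x y \<in> Arr W"
    and Dom_brd [simp]: "Dom W (brd W x y) = x \<odot> y"
    and Cod_brd [simp]: "Cod W (brd W x y) = y \<odot> x"
  using brd_in[OF assms] by (simp_all add: in_Hom)

lemma
  assumes "x \<in> Obj W" "y \<in> Obj W"
  shows ev_Arr [simp]: "ev W x y \<in> Arr W"
    and Dom_ev [simp]: "Dom W (ev W x y) = ihom W x y \<odot> x"
    and Cod_ev [simp]: "Cod W (ev W x y) = y"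
  using ev_in[OF assms] by (simp_all add: in_Hom)

lemma lun_natural: "f \<in> Arr W \<Longrightarrow> lun W (Cod W f) \<cdot> (Idn W (unt W) \<otimes> f) = f \<cdot> lun W (Dom W f)"
  by (rule lun_nat) (simp add: in_Hom)

lemma asc_natural:
  "\<lbrakk>f \<in> Arr W; g \<in> Arr W; h \<in> Arr W\<rbrakk>
    \<Longrightarrow> asc W (Cod W f) (Cod W g) (Cod W h) \<cdot> ((f \<otimes> g) \<otimes> h)
        = (f \<otimes> (g \<otimes> h)) \<cdot> asc W (Dom W f) (Dom W g) (Dom W h)"
  by (rule asc_nat) (simp_all add: in_Hom)

lemma tensA_iso [simp]:
  assumes "is_iso W f" "is_iso W g"
  shows "is_iso W (f \<otimes> g)"
  by (rule is_isoI[of _ "inv_arr W f \<otimes> inv_arr W g"]) (use assms in \<open>simp_all add: iso_Arr\<close>)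

lemma Idn_iso [simp]: "x \<in> Obj W \<Longrightarrow> is_iso W (Idn W x)"
  by (rule is_isoI[of _ "Idn W x"]) simp_all

lemma Comp_iso:
  assumes "is_iso W f" "is_iso W g" "Dom W g = Cod W f"
  shows "is_iso W (g \<cdot> f)"
  by (rule is_isoI[of _ "inv_arr W f \<cdot> inv_arr W g"]) (use assms in \<open>simp_all add: iso_Arr\<close>)

text \<open>Conjugation with the left unitor turns tensoring with the unit into the identity functor.\<close>

lemma unit_tensor_faithful:
  assumes "f \<in> Arr W" "g \<in> Arr W" "Dom W f = Dom W g" "Cod W f = Cod W g"
    and "Idn W (unt W) \<otimes> f = Idn W (unt W) \<otimes> g"
  shows "f = g"
proof (rule iso_cancel_right)
  show "f \<cdot> lun W (Dom W f) = g \<cdot> lun W (Dom W f)"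
    using lun_natural[of f] lun_natural[of g] assms by simp
qed (use assms in simp_all)

text \<open>Kelly's derivation of the second unit triangle from the pentagon and the first one: it suffices to
  compare both sides after tensoring with the unit and precomposing with the isomorphism \<open>?e\<close>, and
  there the pentagon reduces the claim to two instances of the triangle axiom.  The law is what
  removes the unitors when the names of arrows are composed.\<close>

lemma left_unitor_tensor:
  assumes x: "x \<in> Obj W" and y: "y \<in> Obj W"
  shows "lun W (x \<odot> y) \<cdot> asc W (unt W) x y = lun W x \<otimes> Idn W y"
proof (rule unit_tensor_faithful)
  let ?I = "unt W" and ?i = "Idn W (unt W)"
  let ?e = "asc W ?I (?I \<odot> x) y \<cdot> (asc W ?I ?I x \<otimes> Idn W y)"
  have "(?i \<otimes> (lun W (x \<odot> y) \<cdot> asc W ?I x y)) \<cdot> ?e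
      = (?i \<otimes> lun W (x \<odot> y)) \<cdot> ((?i \<otimes> asc W ?I x y) \<cdot> ?e)"
    using x y by simp
  also have "\<dots> = (?i \<otimes> lun W (x \<odot> y)) \<cdot> (asc W ?I ?I (x \<odot> y) \<cdot> asc W (?I \<odot> ?I) x y)"
    using pentagon[of ?I ?I x y] x y by simp
  also have "\<dots> = ((?i \<otimes> lun W (x \<odot> y)) \<cdot> asc W ?I ?I (x \<odot> y)) \<cdot> asc W (?I \<odot> ?I) x y"
    using x y by simp
  also have "\<dots> = (run W ?I \<otimes> (Idn W x \<otimes> Idn W y)) \<cdot> asc W (?I \<odot> ?I) x y"
    using triangle[of ?I "x \<odot> y"] x y by simp
  also have "\<dots> = asc W ?I x y \<cdot> ((run W ?I \<otimes> Idn W x) \<otimes> Idn W y)"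
    using asc_natural[of "run W ?I" "Idn W x" "Idn W y"] x y by simp
  also have "\<dots> = asc W ?I x y \<cdot> (((?i \<otimes> lun W x) \<cdot> asc W ?I ?I x) \<otimes> Idn W y)"
    using triangle[of ?I x] x by simp
  also have "\<dots> = (asc W ?I x y \<cdot> ((?i \<otimes> lun W x) \<otimes> Idn W y)) \<cdot> (asc W ?I ?I x \<otimes> Idn W y)"
    using x y by simp
  also have "\<dots> = (?i \<otimes> (lun W x \<otimes> Idn W y)) \<cdot> ?e"
    using asc_natural[of ?i "lun W x" "Idn W y"] x y by simp
  finally show "?i \<otimes> (lun W (x \<odot> y) \<cdot> asc W ?I x y) = ?i \<otimes> (lun W x \<otimes> Idn W y)"
    by (rule iso_cancel_right[rotated -1]) (use x y in \<open>simp_all add: Comp_iso\<close>)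
qed (use x y in simp_all)

definition uncurry :: "'o \<Rightarrow> 'o \<Rightarrow> 'a \<Rightarrow> 'a" where
  "uncurry x y g = ev W x y \<cdot> (g \<otimes> Idn W x)"

lemma
  assumes "x \<in> Obj W" "y \<in> Obj W" "g \<in> Arr W" "Cod W g = ihom W x y"
  shows uncurry_Arr [simp]: "uncurry x y g \<in> Arr W"
    and Dom_uncurry [simp]: "Dom W (uncurry x y g) = Dom W g \<odot> x"
    and Cod_uncurry [simp]: "Cod W (uncurry x y g) = y"
  unfolding uncurry_def using assms by simp_all

lemma
  assumes "x \<in> Obj W" "y \<in> Obj W" "z \<in> Obj W" "f \<in> Arr W" "Dom W f = z \<odot> x" "Cod W f = y"
  shows curry_Arr [simp]: "curry W z x y f \<in> Arr W"
    and Dom_curry [simp]: "Dom W (curry W z x y f) = z"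
    and Cod_curry [simp]: "Cod W (curry W z x y f) = ihom W x y"
    and uncurry_curry [simp]: "uncurry x y (curry W z x y f) = f"
  using theI'[OF curry_ex1[of x y z f]] assms
  unfolding curry_def[symmetric] by (simp_all add: in_Hom uncurry_def)

lemma uncurry_inj:
  assumes "x \<in> Obj W" "y \<in> Obj W" "g \<in> Arr W" "h \<in> Arr W" "Dom W g = Dom W h"
    "Cod W g = ihom W x y" "Cod W h = ihom W x y" "uncurry x y g = uncurry x y h"
  shows "g = h"
proof -
  have "Dom W g \<in> Obj W" and "uncurry x y g \<in> Hom W (Dom W g \<odot> x) y"
    using assms by (simp_all add: in_Hom)
  from curry_ex1[OF assms(1,2) this] show ?thesis
    using assms unfolding uncurry_def by (auto simp: in_Hom)
qed

lemma uncurry_Idn [simp]: "\<lbrakk>x \<in> Obj W; y \<in> Obj W\<rbrakk> \<Longrightarrow> uncurry x y (Idn W (ihom W x y)) = ev W x y"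
  unfolding uncurry_def by simp

lemma uncurry_Comp:
  assumes "x \<in> Obj W" "y \<in> Obj W" "g \<in> Arr W" "Cod W g = ihom W x y" "h \<in> Arr W" "Dom W g = Cod W h"
  shows "uncurry x y (g \<cdot> h) = uncurry x y g \<cdot> (h \<otimes> Idn W x)"
  unfolding uncurry_def using assms by simp

section \<open>Self-enrichment\<close>

lemma self_simps [simp]: "EObj (self W) = Obj W" "EHom (self W) = ihom W"
  by (simp_all add: self_def)

lemma
  assumes "x \<in> Obj W" "y \<in> Obj W" "z \<in> Obj W"
  shows EComp_self_Arr [simp]: "EComp (self W) x y z \<in> Arr W"
    and Dom_EComp_self [simp]: "Dom W (EComp (self W) x y z) = ihom W y z \<odot> ihom W x y"
    and Cod_EComp_self [simp]: "Cod W (EComp (self W) x y z) = ihom W x z"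
    and uncurry_EComp_self: "uncurry x z (EComp (self W) x y z)
      = ev W y z \<cdot> (Idn W (ihom W y z) \<otimes> ev W x y) \<cdot> asc W (ihom W y z) (ihom W x y) x"
  unfolding self_def using assms by simp_all

text \<open>Composition in the self-enrichment is iterated evaluation.  All later computations with
  \<open>EComp (self W)\<close> go through this law.\<close>

lemma uncurry_EComp_self_tensA:
  assumes obj: "x \<in> Obj W" "y \<in> Obj W" "z \<in> Obj W"
    and g: "g \<in> Arr W" "Cod W g = ihom W y z" and f: "f \<in> Arr W" "Cod W f = ihom W x y"
  shows "uncurry x z (EComp (self W) x y z \<cdot> (g \<otimes> f))
    = uncurry y z g \<cdot> (Idn W (Dom W g) \<otimes> uncurry x y f) \<cdot> asc W (Dom W g) (Dom W f) x"
proof -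
  let ?e = "ev W y z \<cdot> (Idn W (ihom W y z) \<otimes> ev W x y)"
  have "uncurry x z (EComp (self W) x y z \<cdot> (g \<otimes> f))
      = ?e \<cdot> (asc W (ihom W y z) (ihom W x y) x \<cdot> ((g \<otimes> f) \<otimes> Idn W x))"
    using assms by (simp add: uncurry_Comp uncurry_EComp_self)
  also have "\<dots> = ?e \<cdot> ((g \<otimes> (f \<otimes> Idn W x)) \<cdot> asc W (Dom W g) (Dom W f) x)"
    using asc_natural[of g f "Idn W x"] assms by simp
  also have "\<dots> = uncurry y z g \<cdot> (Idn W (Dom W g) \<otimes> uncurry x y f) \<cdot> asc W (Dom W g) (Dom W f) x"
    unfolding uncurry_def using assms by simp
  finally show ?thesis .
qed

text \<open>The inverse of \<open>name_of\<close>: the underlying category of the self-enrichment is \<open>W\<close> itself.\<close>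

definition arrow_of :: "'o \<Rightarrow> 'o \<Rightarrow> 'a \<Rightarrow> 'a" where
  "arrow_of x y t = uncurry x y t \<cdot> inv_arr W (lun W x)"

lemma
  assumes "t \<in> Hom W (unt W) (ihom W x y)" "x \<in> Obj W" "y \<in> Obj W"
  shows arrow_of_Arr [simp]: "arrow_of x y t \<in> Arr W"
    and Dom_arrow_of [simp]: "Dom W (arrow_of x y t) = x"
    and Cod_arrow_of [simp]: "Cod W (arrow_of x y t) = y"
    and uncurry_name: "uncurry x y t = arrow_of x y t \<cdot> lun W x"
  using assms unfolding arrow_of_def in_Hom by simp_all

lemma
  assumes "f \<in> Arr W" "Dom W f = x" "Cod W f = y"
  shows name_of_Hom: "name_of W x y f \<in> Hom W (unt W) (ihom W x y)"
    and arrow_of_name_of [simp]: "arrow_of x y (name_of W x y f) = f"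
  using assms unfolding arrow_of_def name_of_def in_Hom by auto

lemma arrow_of_inj:
  assumes "s \<in> Hom W (unt W) (ihom W x y)" "t \<in> Hom W (unt W) (ihom W x y)" "x \<in> Obj W" "y \<in> Obj W"
  shows "arrow_of x y s = arrow_of x y t \<longleftrightarrow> s = t"
proof
  assume "arrow_of x y s = arrow_of x y t"
  then have "uncurry x y s = uncurry x y t" using assms uncurry_name by simp
  then show "s = t" by (rule uncurry_inj[rotated -1]) (use assms in \<open>simp_all add: in_Hom\<close>)
qed simp

lemma
  assumes "x \<in> Obj W"
  shows EId_self_Hom: "EId (self W) x \<in> Hom W (unt W) (ihom W x x)"
    and arrow_of_EId_self [simp]: "arrow_of x x (EId (self W) x) = Idn W x"
proof -
  have "EId (self W) x = name_of W x x (Idn W x)"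
    using assms by (simp add: self_def name_of_def)
  then show "EId (self W) x \<in> Hom W (unt W) (ihom W x x)" "arrow_of x x (EId (self W) x) = Idn W x"
    using assms name_of_Hom[of "Idn W x"] by simp_all
qed

lemma
  assumes obj: "x \<in> Obj W" "y \<in> Obj W" "z \<in> Obj W"
    and s: "s \<in> Hom W (unt W) (ihom W x y)" and t: "t \<in> Hom W (unt W) (ihom W y z)"
  shows ecompose_self_Hom: "ecompose W (self W) x y z t s \<in> Hom W (unt W) (ihom W x z)"
    and arrow_of_ecompose: "arrow_of x z (ecompose W (self W) x y z t s) = arrow_of y z t \<cdot> arrow_of x y s"
proof -
  let ?I = "unt W" and ?i = "Idn W (unt W)"
  let ?l = "inv_arr W (lun W ?I)"
  have st: "s \<in> Arr W" "Dom W s = ?I" "Cod W s = ihom W x y"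
    "t \<in> Arr W" "Dom W t = ?I" "Cod W t = ihom W y z"
    using s t by (simp_all add: in_Hom)
  show "ecompose W (self W) x y z t s \<in> Hom W ?I (ihom W x z)"
    unfolding ecompose_def using obj st by (simp add: in_Hom)
  have tri: "lun W (?I \<odot> x) \<cdot> asc W ?I ?I x \<cdot> (?l \<otimes> Idn W x) = Idn W (?I \<odot> x)"
    using left_unitor_tensor[of ?I x] obj by (simp del: assoc)
  have "uncurry x z (ecompose W (self W) x y z t s)
      = uncurry x z (EComp (self W) x y z \<cdot> (t \<otimes> s)) \<cdot> (?l \<otimes> Idn W x)"
    unfolding ecompose_def using obj st by (subst uncurry_Comp) simp_all
  also have "\<dots> = uncurry y z t \<cdot> (?i \<otimes> uncurry x y s) \<cdot> asc W ?I ?I x \<cdot> (?l \<otimes> Idn W x)"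
    using uncurry_EComp_self_tensA[OF obj, of t s] st by simp
  also have "uncurry y z t = arrow_of y z t \<cdot> lun W y" using t obj by (simp add: uncurry_name)
  also have "arrow_of y z t \<cdot> lun W y \<cdot> (?i \<otimes> uncurry x y s)
      = arrow_of y z t \<cdot> (uncurry x y s \<cdot> lun W (?I \<odot> x))"
    using lun_natural[of "uncurry x y s"] s t st obj by simp
  also have "\<dots> \<cdot> asc W ?I ?I x \<cdot> (?l \<otimes> Idn W x)
      = arrow_of y z t \<cdot> uncurry x y s \<cdot> (lun W (?I \<odot> x) \<cdot> asc W ?I ?I x \<cdot> (?l \<otimes> Idn W x))"
    using s t st obj by simp
  also have "\<dots> = arrow_of y z t \<cdot> uncurry x y s" unfolding tri using s t st obj by simp
  finally show "arrow_of x z (ecompose W (self W) x y z t s) = arrow_of y z t \<cdot> arrow_of x y s"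
    unfolding arrow_of_def using obj st by simp
qed

text \<open>Precomposition with the name of an arrow is evaluation after that arrow; the unitor that occurs is
  the right one, and the triangle axiom removes it.\<close>

lemma uncurry_precomp:
  assumes obj: "a \<in> Obj W" "b \<in> Obj W" "c \<in> Obj W" and f: "f \<in> Arr W" "Dom W f = a" "Cod W f = b"
  shows "uncurry a c (precomp W (self W) a b c (name_of W a b f))
    = ev W b c \<cdot> (Idn W (ihom W b c) \<otimes> f)"
proof -
  let ?n = "name_of W a b f" and ?h = "ihom W b c" and ?I = "unt W"
  let ?r = "inv_arr W (run W ?h) \<otimes> Idn W a"
  have n: "?n \<in> Arr W" "Dom W ?n = ?I" "Cod W ?n = ihom W a b" and un: "uncurry a b ?n = f \<cdot> lun W a"
    using name_of_Hom[OF f] uncurry_name[OF name_of_Hom[OF f]] f obj by (simp_all add: in_Hom)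
  have "uncurry a c (precomp W (self W) a b c ?n)
      = uncurry a c (EComp (self W) a b c \<cdot> (Idn W ?h \<otimes> ?n)) \<cdot> ?r"
    unfolding precomp_def using obj n by (simp add: uncurry_Comp)
  also have "\<dots> = uncurry b c (Idn W ?h) \<cdot> (Idn W ?h \<otimes> uncurry a b ?n) \<cdot> asc W ?h ?I a \<cdot> ?r"
    using uncurry_EComp_self_tensA[OF obj, of "Idn W ?h" ?n] obj n by simp
  also have "\<dots> = ev W b c \<cdot> (Idn W ?h \<otimes> f) \<cdot> ((Idn W ?h \<otimes> lun W a) \<cdot> asc W ?h ?I a) \<cdot> ?r"
    unfolding un using obj f by simp
  also have "\<dots> = ev W b c \<cdot> (Idn W ?h \<otimes> f)"
    unfolding triangle[OF ihom_Obj[OF obj(2,3)] obj(1)] using obj f by simp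
  finally show ?thesis .
qed

end

section \<open>Enriched functors into the base as actions\<close>

context symmetric_monoidal_closed
begin

definition action :: "('x, 'o, 'a) efun \<Rightarrow> 'x \<Rightarrow> 'x \<Rightarrow> 'a" where
  "action A x y = uncurry (EFO A x) (EFO A y) (EFA A x y)"

text \<open>The typing of identities and composition.  The axioms of enriched functors are equations between
  arrows built from these data, so typing is what their translation into actions requires; it
  passes to the opposite without any coherence computation.\<close>

definition enriched_data :: "('x, 'o, 'a) ecat \<Rightarrow> bool" where
  "enriched_data X \<longleftrightarrow>
     (\<forall>x\<in>EObj X. EId X x \<in> Hom W (unt W) (EHom X x x)) \<and>
     (\<forall>x\<in>EObj X. \<forall>y\<in>EObj X. \<forall>z\<in>EObj X.
        EComp X x y z \<in> Hom W (EHom X y z \<odot> EHom X x y) (EHom X x z))"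

lemma enriched_dataD:
  assumes "enriched_data X" "x \<in> EObj X"
  shows "EId X x \<in> Hom W (unt W) (EHom X x x)"
    and "\<lbrakk>y \<in> EObj X; z \<in> EObj X\<rbrakk>
      \<Longrightarrow> EComp X x y z \<in> Hom W (EHom X y z \<odot> EHom X x y) (EHom X x z)"
  using assms unfolding enriched_data_def by simp_all

lemma enriched_data_op:
  assumes "enriched_category W X"
  shows "enriched_data (op_ecat W X)"
  using assms unfolding enriched_data_def enriched_category_def op_ecat_def in_Hom by simp

definition component :: "('x, 'o, 'a) efun \<Rightarrow> ('x, 'o, 'a) efun \<Rightarrow> ('x \<Rightarrow> 'a) \<Rightarrow> 'x \<Rightarrow> 'a" where
  "component A B t x = arrow_of (EFO A x) (EFO B x) (t x)"

lemma
  assumes "enriched_functor W X (self W) A" and "x \<in> EObj X"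
  shows EFO_Obj [simp]: "EFO A x \<in> Obj W"
    and EHom_Obj: "y \<in> EObj X \<Longrightarrow> EHom X x y \<in> Obj W"
    and EFA_Hom: "y \<in> EObj X \<Longrightarrow> EFA A x y \<in> Hom W (EHom X x y) (ihom W (EFO A x) (EFO A y))"
    and action_Arr: "y \<in> EObj X \<Longrightarrow> action A x y \<in> Arr W"
    and Dom_action: "y \<in> EObj X \<Longrightarrow> Dom W (action A x y) = EHom X x y \<odot> EFO A x"
    and Cod_action: "y \<in> EObj X \<Longrightarrow> Cod W (action A x y) = EFO A y"
proof -
  show x: "EFO A x \<in> Obj W" using assms by (simp add: enriched_functor_def)
  assume y: "y \<in> EObj X"
  have y': "EFO A y \<in> Obj W" using assms y by (simp add: enriched_functor_def)
  show h: "EFA A x y \<in> Hom W (EHom X x y) (ihom W (EFO A x) (EFO A y))"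
    using assms y by (simp add: enriched_functor_def)
  show "EHom X x y \<in> Obj W" "action A x y \<in> Arr W" "Dom W (action A x y) = EHom X x y \<odot> EFO A x"
    "Cod W (action A x y) = EFO A y"
    using h x y' Obj_Dom[of "EFA A x y"] unfolding action_def in_Hom by auto
qed

text \<open>Transposing the two functor axioms yields the unit and associativity laws of a module; transposition
  is injective, so nothing is lost.\<close>

lemma enriched_functor_self_iff:
  assumes X: "enriched_data X"
    and obj: "\<And>x. x \<in> EObj X \<Longrightarrow> EFO A x \<in> Obj W"
    and arr: "\<And>x y. \<lbrakk>x \<in> EObj X; y \<in> EObj X\<rbrakk>
      \<Longrightarrow> EFA A x y \<in> Hom W (EHom X x y) (ihom W (EFO A x) (EFO A y))"
  shows "enriched_functor W X (self W) A \<longleftrightarrow>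
     (\<forall>x\<in>EObj X. action A x x \<cdot> (EId X x \<otimes> Idn W (EFO A x)) = lun W (EFO A x)) \<and>
     (\<forall>x\<in>EObj X. \<forall>y\<in>EObj X. \<forall>z\<in>EObj X.
        action A x z \<cdot> (EComp X x y z \<otimes> Idn W (EFO A x))
        = action A y z \<cdot> (Idn W (EHom X y z) \<otimes> action A x y)
            \<cdot> asc W (EHom X y z) (EHom X x y) (EFO A x))"
proof -
  note EId = enriched_dataD(1)[OF X] and EComp = enriched_dataD(2)[OF X]
  have hom: "EHom X x y \<in> Obj W" if "x \<in> EObj X" "y \<in> EObj X" for x y
    using arr[OF that] Obj_Dom[of "EFA A x y"] by (auto simp: in_Hom)
  have "EFA A x x \<cdot> EId X x = EId (self W) (EFO A x) \<longleftrightarrow>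
      action A x x \<cdot> (EId X x \<otimes> Idn W (EFO A x)) = lun W (EFO A x)" (is "?f = ?g \<longleftrightarrow> ?r")
    if x: "x \<in> EObj X" for x
  proof -
    note t = obj[OF x] arr[OF x x, unfolded in_Hom] EId[OF x, unfolded in_Hom]
      EId_self_Hom[OF obj[OF x], unfolded in_Hom]
    have "?f = ?g \<longleftrightarrow> uncurry (EFO A x) (EFO A x) ?f = uncurry (EFO A x) (EFO A x) ?g"
      using uncurry_inj[of "EFO A x" "EFO A x" ?f ?g] t by auto
    also have "uncurry (EFO A x) (EFO A x) ?f = action A x x \<cdot> (EId X x \<otimes> Idn W (EFO A x))"
      unfolding action_def using t by (simp add: uncurry_Comp)
    also have "uncurry (EFO A x) (EFO A x) ?g = lun W (EFO A x)"
      using t(1) by (simp add: uncurry_name EId_self_Hom)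
    finally show ?thesis .
  qed
  moreover have "EFA A x z \<cdot> EComp X x y z
      = EComp (self W) (EFO A x) (EFO A y) (EFO A z) \<cdot> (EFA A y z \<otimes> EFA A x y)
    \<longleftrightarrow> action A x z \<cdot> (EComp X x y z \<otimes> Idn W (EFO A x))
        = action A y z \<cdot> (Idn W (EHom X y z) \<otimes> action A x y)
            \<cdot> asc W (EHom X y z) (EHom X x y) (EFO A x)" (is "?f = ?g \<longleftrightarrow> ?r = ?s")
    if x: "x \<in> EObj X" and y: "y \<in> EObj X" and z: "z \<in> EObj X" for x y z
  proof -
    note t = obj[OF x] obj[OF y] obj[OF z] hom[OF x y] hom[OF y z] hom[OF x z]
      arr[OF x y, unfolded in_Hom] arr[OF y z, unfolded in_Hom] arr[OF x z, unfolded in_Hom]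
      EComp[OF x y z, unfolded in_Hom]
    have "?f = ?g \<longleftrightarrow> uncurry (EFO A x) (EFO A z) ?f = uncurry (EFO A x) (EFO A z) ?g"
      using uncurry_inj[of "EFO A x" "EFO A z" ?f ?g] t by auto
    also have "uncurry (EFO A x) (EFO A z) ?f = ?r"
      unfolding action_def using t by (simp add: uncurry_Comp)
    also have "uncurry (EFO A x) (EFO A z) ?g = ?s"
      unfolding action_def using t by (simp add: uncurry_EComp_self_tensA)
    finally show ?thesis .
  qed
  ultimately show ?thesis
    unfolding enriched_functor_def self_simps using obj arr by simp
qed

lemma
  assumes "enriched_functor W X (self W) A" "enriched_functor W X (self W) B"
    and "t x \<in> Hom W (unt W) (ihom W (EFO A x) (EFO B x))" and "x \<in> EObj X"
  shows component_Arr: "component A B t x \<in> Arr W"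
    and Dom_component: "Dom W (component A B t x) = EFO A x"
    and Cod_component: "Cod W (component A B t x) = EFO B x"
  using assms unfolding component_def by simp_all

text \<open>The two sides of the naturality axiom, uncurried, are the two ways around the square formed by
  the actions and the components.  The unitors cancel by \<open>left_unitor_tensor\<close> on one side and by the
  triangle axiom on the other.\<close>

lemma enriched_nat_self_iff:
  assumes A: "enriched_functor W X (self W) A" and B: "enriched_functor W X (self W) B"
  shows "enriched_nat W X (self W) A B t \<longleftrightarrow>
    (\<forall>x\<in>EObj X. t x \<in> Hom W (unt W) (ihom W (EFO A x) (EFO B x))) \<and>
    (\<forall>x\<in>EObj X. \<forall>y\<in>EObj X. component A B t y \<cdot> action A x y
       = action B x y \<cdot> (Idn W (EHom X x y) \<otimes> component A B t x))"
proof -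
  have "EComp (self W) (EFO A x) (EFO A y) (EFO B y)
          \<cdot> (t y \<otimes> EFA A x y) \<cdot> inv_arr W (lun W (EHom X x y))
      = EComp (self W) (EFO A x) (EFO B x) (EFO B y)
          \<cdot> (EFA B x y \<otimes> t x) \<cdot> inv_arr W (run W (EHom X x y)) \<longleftrightarrow>
      component A B t y \<cdot> action A x y
        = action B x y \<cdot> (Idn W (EHom X x y) \<otimes> component A B t x)" (is "?f = ?g \<longleftrightarrow> ?r = ?s")
    if x: "x \<in> EObj X" and y: "y \<in> EObj X"
      and tx: "t x \<in> Hom W (unt W) (ihom W (EFO A x) (EFO B x))"
      and ty: "t y \<in> Hom W (unt W) (ihom W (EFO A y) (EFO B y))" for x y
  proof -
    let ?I = "unt W" and ?i = "Idn W (unt W)" and ?h = "EHom X x y"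
    let ?a = "EFO A x" and ?a' = "EFO A y" and ?b = "EFO B x" and ?b' = "EFO B y"
    note obj = EFO_Obj[OF A x] EFO_Obj[OF A y] EFO_Obj[OF B x] EFO_Obj[OF B y] EHom_Obj[OF A x y]
    note hom = EFA_Hom[OF A x y, unfolded in_Hom] EFA_Hom[OF B x y, unfolded in_Hom]
      tx[unfolded in_Hom] ty[unfolded in_Hom]
    note act = action_Arr[OF A x y] Dom_action[OF A x y] Cod_action[OF A x y]
      action_Arr[OF B x y] Dom_action[OF B x y] Cod_action[OF B x y]
    note cmp = component_Arr[where t = t, OF A B tx x] Dom_component[where t = t, OF A B tx x]
      Cod_component[where t = t, OF A B tx x] component_Arr[where t = t, OF A B ty y]
      Dom_component[where t = t, OF A B ty y] Cod_component[where t = t, OF A B ty y]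
    have un: "uncurry ?a ?b (t x) = component A B t x \<cdot> lun W ?a"
      "uncurry ?a' ?b' (t y) = component A B t y \<cdot> lun W ?a'"
      unfolding component_def using obj tx ty by (simp_all add: uncurry_name)
    let ?l = "inv_arr W (lun W ?h) \<otimes> Idn W ?a" and ?r' = "inv_arr W (run W ?h) \<otimes> Idn W ?a"
    have fg: "?f \<in> Arr W" "?g \<in> Arr W" "Dom W ?f = ?h" "Dom W ?g = ?h"
      "Cod W ?f = ihom W ?a ?b'" "Cod W ?g = ihom W ?a ?b'"
      using obj hom by simp_all
    have kelly: "lun W (?h \<odot> ?a) \<cdot> asc W ?I ?h ?a \<cdot> ?l = Idn W (?h \<odot> ?a)"
      using left_unitor_tensor[of ?h ?a] obj by (simp del: assoc)
    have "uncurry ?a ?b' ?f = uncurry ?a ?b' (EComp (self W) ?a ?a' ?b' \<cdot> (t y \<otimes> EFA A x y)) \<cdot> ?l"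
      using obj hom by (subst uncurry_Comp) simp_all
    also have "\<dots> = uncurry ?a' ?b' (t y) \<cdot> (?i \<otimes> action A x y) \<cdot> asc W ?I ?h ?a \<cdot> ?l"
      unfolding action_def
      using uncurry_EComp_self_tensA[of ?a ?a' ?b' "t y" "EFA A x y"] obj hom by simp
    also have "uncurry ?a' ?b' (t y) \<cdot> (?i \<otimes> action A x y)
        = component A B t y \<cdot> (action A x y \<cdot> lun W (?h \<odot> ?a))"
      using lun_natural[of "action A x y"] obj act cmp unfolding un by simp
    also have "\<dots> \<cdot> asc W ?I ?h ?a \<cdot> ?l
        = component A B t y \<cdot> action A x y \<cdot> (lun W (?h \<odot> ?a) \<cdot> asc W ?I ?h ?a \<cdot> ?l)"
      using obj act cmp by simp
    also have "\<dots> = ?r" unfolding kelly using obj act cmp by simp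
    finally have f: "uncurry ?a ?b' ?f = ?r" .
    have "uncurry ?a ?b' ?g = uncurry ?a ?b' (EComp (self W) ?a ?b ?b' \<cdot> (EFA B x y \<otimes> t x)) \<cdot> ?r'"
      using obj hom by (subst uncurry_Comp) simp_all
    also have "\<dots> = action B x y \<cdot> (Idn W ?h \<otimes> uncurry ?a ?b (t x)) \<cdot> asc W ?h ?I ?a \<cdot> ?r'"
      unfolding action_def
      using uncurry_EComp_self_tensA[of ?a ?b ?b' "EFA B x y" "t x"] obj hom by simp
    also have "\<dots> = ?s \<cdot> ((Idn W ?h \<otimes> lun W ?a) \<cdot> asc W ?h ?I ?a) \<cdot> ?r'"
      unfolding un using obj act cmp by simp
    also have "\<dots> = ?s"
      unfolding triangle[OF obj(5,1)] using obj act cmp by simp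
    finally have g: "uncurry ?a ?b' ?g = ?s" .
    have "?f = ?g \<longleftrightarrow> uncurry ?a ?b' ?f = uncurry ?a ?b' ?g"
      using uncurry_inj[OF obj(1,4) fg(1,2)] fg by metis
    then show ?thesis unfolding f g .
  qed
  then show ?thesis
    unfolding enriched_nat_def self_simps by blast
qed

lemma component_enat_comp:
  assumes "enriched_functor W X (self W) A" "enriched_functor W X (self W) B"
    "enriched_functor W X (self W) K" and "x \<in> EObj X"
    and "s x \<in> Hom W (unt W) (ihom W (EFO A x) (EFO B x))"
      "t x \<in> Hom W (unt W) (ihom W (EFO B x) (EFO K x))"
  shows "component A K (enat_comp W (self W) A B K t s) x = component B K t x \<cdot> component A B s x"
    and "enat_comp W (self W) A B K t s x \<in> Hom W (unt W) (ihom W (EFO A x) (EFO K x))"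
  unfolding component_def enat_comp_def using assms
  by (simp_all add: arrow_of_ecompose ecompose_self_Hom)

section \<open>The subobject preorder\<close>

text \<open>The bijection \<open>arrow_of\<close> turns composition in the underlying category of the self-enrichment into
  composition in \<open>W\<close>, so cancellation transfers in both directions.\<close>

lemma monic_underlying_self_iff:
  assumes obj: "a \<in> Obj W" "b \<in> Obj W" and t: "t \<in> Hom W (unt W) (ihom W a b)"
  shows "monic (underlying W (self W)) (a, t, b) \<longleftrightarrow> monic W (arrow_of a b t)"
proof
  let ?S = "underlying W (self W)"
  have Hom_S: "g \<in> Hom ?S w a \<longleftrightarrow> (\<exists>g'\<in>Hom W (unt W) (ihom W w a). g = (w, g', a)) \<and> w \<in> Obj W" for g w
    using obj by (auto simp: underlying_def in_Hom)
  have Dom_S: "Dom ?S (a, t, b) = a" by (simp add: underlying_def)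
  have Comp_S: "Comp ?S (a, t, b) (w, g, a) = (w, ecompose W (self W) w a b t g, b)" for w g
    by (simp add: underlying_def)
  have eq: "ecompose W (self W) w a b t g = ecompose W (self W) w a b t h \<longleftrightarrow>
      arrow_of a b t \<cdot> arrow_of w a g = arrow_of a b t \<cdot> arrow_of w a h"
    if "w \<in> Obj W" "g \<in> Hom W (unt W) (ihom W w a)" "h \<in> Hom W (unt W) (ihom W w a)" for w g h
    using arrow_of_inj[OF ecompose_self_Hom ecompose_self_Hom] that obj t by (metis arrow_of_ecompose)
  {
    assume m: "monic ?S (a, t, b)"
    show "monic W (arrow_of a b t)"
    proof (rule monicI)
      show "arrow_of a b t \<in> Arr W" using obj t by simp
      fix g h assume gh: "g \<in> Arr W" "h \<in> Arr W" "Dom W g = Dom W h"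
        "Cod W g = Dom W (arrow_of a b t)" "Cod W h = Dom W (arrow_of a b t)"
        and e: "arrow_of a b t \<cdot> g = arrow_of a b t \<cdot> h"
      let ?w = "Dom W h"
      have w: "?w \<in> Obj W" using gh by simp
      have ca: "Cod W g = a" "Cod W h = a" using gh obj t by simp_all
      note n = name_of_Hom[OF gh(1,3) ca(1)] name_of_Hom[OF gh(2) HOL.refl ca(2)]
      have "ecompose W (self W) ?w a b t (name_of W ?w a g) = ecompose W (self W) ?w a b t (name_of W ?w a h)"
        using eq[OF w n] gh ca e by simp
      then have "Comp ?S (a, t, b) (?w, name_of W ?w a g, a) = Comp ?S (a, t, b) (?w, name_of W ?w a h, a)"
        unfolding Comp_S by simp
      moreover have "(?w, name_of W ?w a g, a) \<in> Hom ?S ?w a" "(?w, name_of W ?w a h, a) \<in> Hom ?S ?w a"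
        using Hom_S n w by blast+
      moreover have "?w \<in> Obj ?S" using w by (simp add: underlying_def)
      ultimately have "(?w, name_of W ?w a g, a) = (?w, name_of W ?w a h, a)"
        using m unfolding monic_def Dom_S by blast
      then have "arrow_of ?w a (name_of W ?w a g) = arrow_of ?w a (name_of W ?w a h)" by simp
      then show "g = h" using gh ca by simp
    qed
  next
    assume m: "monic W (arrow_of a b t)"
    show "monic ?S (a, t, b)"
      unfolding monic_def
    proof (intro conjI ballI impI)
      show "(a, t, b) \<in> Arr ?S" using obj t by (simp add: underlying_def)
      fix w g h assume "g \<in> Hom ?S w (Dom ?S (a, t, b))" "h \<in> Hom ?S w (Dom ?S (a, t, b))"
        and e: "Comp ?S (a, t, b) g = Comp ?S (a, t, b) h"
      then obtain g' h' where gh: "g' \<in> Hom W (unt W) (ihom W w a)" "h' \<in> Hom W (unt W) (ihom W w a)"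
        "g = (w, g', a)" "h = (w, h', a)" and w: "w \<in> Obj W"
        using Hom_S unfolding Dom_S by auto
      have "arrow_of a b t \<cdot> arrow_of w a g' = arrow_of a b t \<cdot> arrow_of w a h'"
        using e eq[OF w gh(1,2)] unfolding gh Comp_S by simp
      then have "arrow_of w a g' = arrow_of w a h'"
        using monicD[OF m, of "arrow_of w a g'" "arrow_of w a h'"] gh obj w t by simp
      then show "g = h" using arrow_of_inj[OF gh(1,2) w obj(1)] gh by simp
    qed
  }
qed

lemma Monos_iff:
  "(A, r) \<in> Monos W X K \<longleftrightarrow> enriched_functor W X (self W) A \<and> enriched_functor W X (self W) K \<and>
     enriched_nat W X (self W) A K r \<and> (\<forall>x\<in>EObj X. monic W (component A K r x))"
proof -
  have "monic (underlying W (self W)) (EFO A x, r x, EFO K x) \<longleftrightarrow> monic W (component A K r x)"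
    if "enriched_functor W X (self W) A" "enriched_functor W X (self W) K"
      "enriched_nat W X (self W) A K r" "x \<in> EObj X" for x
    using that monic_underlying_self_iff[of "EFO A x" "EFO K x" "r x"] enriched_nat_self_iff[OF that(1,2)]
    unfolding component_def by simp
  then show ?thesis unfolding Monos_def by auto
qed

lemma Monos_component:
  assumes "(A, r) \<in> Monos W X K" "x \<in> EObj X"
  shows "r x \<in> Hom W (unt W) (ihom W (EFO A x) (EFO K x))"
    and "component A K r x \<in> Arr W" "Dom W (component A K r x) = EFO A x"
      "Cod W (component A K r x) = EFO K x" "monic W (component A K r x)"
proof -
  have A: "enriched_functor W X (self W) A" and K: "enriched_functor W X (self W) K"
    and r: "enriched_nat W X (self W) A K r"
    using assms unfolding Monos_iff by simp_all
  then show r': "r x \<in> Hom W (unt W) (ihom W (EFO A x) (EFO K x))"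
    using assms enriched_nat_self_iff[OF A K] by simp
  show "component A K r x \<in> Arr W" "Dom W (component A K r x) = EFO A x"
      "Cod W (component A K r x) = EFO K x"
    unfolding component_def using A K r' assms(2) by simp_all
  show "monic W (component A K r x)" using assms unfolding Monos_iff by simp
qed

text \<open>A family of factors is automatically natural: cancel the monomorphism \<open>component A K r y\<close> from the
  naturality square.  This reduces the order on subobjects to arrows of \<open>W\<close>.\<close>

lemma mono_ge_iff:
  assumes r: "(A, r) \<in> Monos W X K" and s: "(B, s) \<in> Monos W X K"
  shows "mono_ge W X K (A, r) (B, s) \<longleftrightarrow>
    (\<forall>x\<in>EObj X. \<exists>f\<in>Hom W (EFO B x) (EFO A x). component A K r x \<cdot> f = component B K s x)"
proof
  have A: "enriched_functor W X (self W) A" and B: "enriched_functor W X (self W) B"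
    and K: "enriched_functor W X (self W) K"
    and r': "enriched_nat W X (self W) A K r" and s': "enriched_nat W X (self W) B K s"
    using r s unfolding Monos_iff by simp_all
  {
    assume "mono_ge W X K (A, r) (B, s)"
    then obtain t where t: "enriched_nat W X (self W) B A t"
      and e: "\<And>x. x \<in> EObj X \<Longrightarrow> s x = enat_comp W (self W) B A K r t x"
      unfolding mono_ge_def by auto
    show "\<forall>x\<in>EObj X. \<exists>f\<in>Hom W (EFO B x) (EFO A x). component A K r x \<cdot> f = component B K s x"
    proof (intro ballI bexI)
      fix x assume x: "x \<in> EObj X"
      have tx: "t x \<in> Hom W (unt W) (ihom W (EFO B x) (EFO A x))"
        using t enriched_nat_self_iff[OF B A] x by simp
      show "component B A t x \<in> Hom W (EFO B x) (EFO A x)"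
        unfolding component_def in_Hom using A B tx x by simp
      show "component A K r x \<cdot> component B A t x = component B K s x"
        using component_enat_comp(1)[of X B A K x t r] A B K x tx Monos_component(1)[OF r x] e[OF x]
        unfolding component_def by simp
    qed
  next
    assume "\<forall>x\<in>EObj X. \<exists>f\<in>Hom W (EFO B x) (EFO A x). component A K r x \<cdot> f = component B K s x"
    then obtain f where f: "\<And>x. x \<in> EObj X \<Longrightarrow> f x \<in> Hom W (EFO B x) (EFO A x)"
      and e: "\<And>x. x \<in> EObj X \<Longrightarrow> component A K r x \<cdot> f x = component B K s x"
      by metis
    define t where "t = (\<lambda>x. name_of W (EFO B x) (EFO A x) (f x))"
    have t: "t x \<in> Hom W (unt W) (ihom W (EFO B x) (EFO A x))" "component B A t x = f x"
      if "x \<in> EObj X" for x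
      using f[OF that] unfolding t_def component_def by (simp_all add: in_Hom name_of_Hom[unfolded in_Hom])
    have "enriched_nat W X (self W) B A t"
      unfolding enriched_nat_self_iff[OF B A]
    proof (intro conjI ballI)
      fix x y assume x: "x \<in> EObj X" and y: "y \<in> EObj X"
      let ?h = "Idn W (EHom X x y)"
      note obj = EFO_Obj[OF A x] EFO_Obj[OF A y] EFO_Obj[OF B x] EFO_Obj[OF B y]
        EFO_Obj[OF K x] EFO_Obj[OF K y] EHom_Obj[OF A x y]
      note act = action_Arr[OF A x y] Dom_action[OF A x y] Cod_action[OF A x y]
        action_Arr[OF B x y] Dom_action[OF B x y] Cod_action[OF B x y]
        action_Arr[OF K x y] Dom_action[OF K x y] Cod_action[OF K x y]
      note cmp = Monos_component(2-4)[OF r x] Monos_component(2-4)[OF r y]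
        Monos_component(2-4)[OF s x] Monos_component(2-4)[OF s y]
        f[OF x, unfolded in_Hom] f[OF y, unfolded in_Hom]
      have nr: "component A K r y \<cdot> action A x y = action K x y \<cdot> (?h \<otimes> component A K r x)"
        using r' x y enriched_nat_self_iff[OF A K] by simp
      have ns: "component B K s y \<cdot> action B x y = action K x y \<cdot> (?h \<otimes> component B K s x)"
        using s' x y enriched_nat_self_iff[OF B K] by simp
      have "component A K r y \<cdot> (f y \<cdot> action B x y) = (component A K r y \<cdot> f y) \<cdot> action B x y"
        using obj act cmp by simp
      also have "\<dots> = action K x y \<cdot> (?h \<otimes> component B K s x)"
        unfolding e[OF y] by (rule ns)
      also have "\<dots> = action K x y \<cdot> (?h \<otimes> component A K r x) \<cdot> (?h \<otimes> f x)"
        unfolding e[OF x, symmetric] using obj act cmp by simp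
      also have "\<dots> = component A K r y \<cdot> (action A x y \<cdot> (?h \<otimes> f x))"
        unfolding nr[symmetric] using obj act cmp by simp
      finally have "f y \<cdot> action B x y = action A x y \<cdot> (?h \<otimes> f x)"
        by (rule monicD[OF Monos_component(5)[OF r y], rotated -1]) (use obj act cmp in simp_all)
      then show "component B A t y \<cdot> action B x y = action A x y \<cdot> (?h \<otimes> component B A t x)"
        unfolding t(2)[OF x] t(2)[OF y] .
    qed (fact t(1))
    moreover have "s x = enat_comp W (self W) B A K r t x" if x: "x \<in> EObj X" for x
    proof -
      note c = component_enat_comp[where s = t and t = r, OF B A K x t(1)[OF x] Monos_component(1)[OF r x]]
      have "component B K (enat_comp W (self W) B A K r t) x = component B K s x"
        unfolding c(1) t(2)[OF x] by (rule e[OF x])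
      then show ?thesis
        using arrow_of_inj[OF c(2) Monos_component(1)[OF s x]] EFO_Obj[OF B x] EFO_Obj[OF K x]
        unfolding component_def by simp
    qed
    ultimately show "mono_ge W X K (A, r) (B, s)" unfolding mono_ge_def by auto
  }
qed

lemma preordered_Monos: "preordered_set (Monos W X K) (mono_ge W X K)"
proof
  fix a assume a: "a \<in> Monos W X K"
  obtain A r where [simp]: "a = (A, r)" by (cases a)
  have "component A K r x \<cdot> Idn W (EFO A x) = component A K r x \<and> Idn W (EFO A x) \<in> Hom W (EFO A x) (EFO A x)"
    if "x \<in> EObj X" for x
    using Monos_component[of A r X K x] a that Idn_in[of "EFO A x"] Obj_Dom by fastforce
  then show "mono_ge W X K a a" using a by (auto simp: mono_ge_iff)
next
  fix a b c assume abc: "a \<in> Monos W X K" "b \<in> Monos W X K" "c \<in> Monos W X K"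
    and ge: "mono_ge W X K a b" "mono_ge W X K b c"
  obtain A r where a: "a = (A, r)" by (cases a)
  obtain B s where b: "b = (B, s)" by (cases b)
  obtain D t where c: "c = (D, t)" by (cases c)
  note M = abc[unfolded a b c]
  show "mono_ge W X K a c"
    unfolding a c mono_ge_iff[OF M(1,3)]
  proof
    fix x assume x: "x \<in> EObj X"
    obtain f g where f: "f \<in> Hom W (EFO B x) (EFO A x)" "component A K r x \<cdot> f = component B K s x"
      and g: "g \<in> Hom W (EFO D x) (EFO B x)" "component B K s x \<cdot> g = component D K t x"
      using ge x unfolding a b c mono_ge_iff[OF M(1,2)] mono_ge_iff[OF M(2,3)] by blast
    have "component A K r x \<cdot> (f \<cdot> g) = component D K t x"
      using Comp_assoc[of g _ _ f _ "component A K r x"] f g Monos_component[OF M(1) x]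
      unfolding in_Hom by simp
    moreover have "f \<cdot> g \<in> Hom W (EFO D x) (EFO A x)" using f g by (auto simp: in_Hom)
    ultimately show "\<exists>f\<in>Hom W (EFO D x) (EFO A x). component A K r x \<cdot> f = component D K t x" by blast
  qed
qed

text \<open>Mutual factorizations of two monomorphisms are inverse to each other, because their composites
  become identities after cancellation of a monomorphism.\<close>

lemma mono_equiv_iff:
  assumes r: "(A, r) \<in> Monos W X K" and s: "(B, s) \<in> Monos W X K"
  shows "((A, r), (B, s)) \<in> mono_equiv W X K \<longleftrightarrow>
    mono_ge W X K (A, r) (B, s) \<and> mono_ge W X K (B, s) (A, r)" (is "?l \<longleftrightarrow> ?r")
proof
  have A: "enriched_functor W X (self W) A" and B: "enriched_functor W X (self W) B"
    and K: "enriched_functor W X (self W) K"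
    using r s unfolding Monos_iff by simp_all
  {
    assume ?l
    then obtain t where t: "enat_iso W X (self W) A B t"
      and e: "\<And>x. x \<in> EObj X \<Longrightarrow> r x = enat_comp W (self W) A B K s t x"
      unfolding mono_equiv_def by auto
    then obtain t' where nat: "enriched_nat W X (self W) A B t" "enriched_nat W X (self W) B A t'"
      and inv: "\<And>x. x \<in> EObj X \<Longrightarrow> enat_comp W (self W) B A B t t' x = EId (self W) (EFO B x)"
      unfolding enat_iso_def by auto
    have ge: "mono_ge W X K (B, s) (A, r)"
      using nat e unfolding mono_ge_def by auto
    have "mono_ge W X K (A, r) (B, s)"
      unfolding mono_ge_iff[OF r s]
    proof (intro ballI bexI)
      fix x assume x: "x \<in> EObj X"
      have tx: "t x \<in> Hom W (unt W) (ihom W (EFO A x) (EFO B x))"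
        and tx': "t' x \<in> Hom W (unt W) (ihom W (EFO B x) (EFO A x))"
        using nat enriched_nat_self_iff[OF B A] enriched_nat_self_iff[OF A B] x by simp_all
      have c: "component A B t x \<in> Hom W (EFO A x) (EFO B x)"
        "component B A t' x \<in> Hom W (EFO B x) (EFO A x)"
        unfolding component_def in_Hom using A B tx tx' x by simp_all
      then show "component B A t' x \<in> Hom W (EFO B x) (EFO A x)" by simp
      have "component A K r x = component B K s x \<cdot> component A B t x"
        using component_enat_comp(1)[where s = t and t = s, OF A B K x tx Monos_component(1)[OF s x]] e[OF x]
        unfolding component_def by simp
      moreover have "component A B t x \<cdot> component B A t' x = Idn W (EFO B x)"
        using component_enat_comp(1)[where s = t' and t = t, OF B A B x tx' tx] inv[OF x] EFO_Obj[OF B x]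
        unfolding component_def by simp
      ultimately show "component A K r x \<cdot> component B A t' x = component B K s x"
        using c Monos_component[OF s x] unfolding in_Hom by simp
    qed
    with ge show ?r by simp
  next
    assume ?r
    then obtain t t' where nat: "enriched_nat W X (self W) A B t" "enriched_nat W X (self W) B A t'"
      and e: "\<And>x. x \<in> EObj X \<Longrightarrow> r x = enat_comp W (self W) A B K s t x"
      and e': "\<And>x. x \<in> EObj X \<Longrightarrow> s x = enat_comp W (self W) B A K r t' x"
      unfolding mono_ge_def by auto
    have id: "enat_comp W (self W) A B A u' u x = EId (self W) (EFO A x)"
      if A: "(A, r) \<in> Monos W X K" and B: "(B, s) \<in> Monos W X K"
        and u: "enriched_nat W X (self W) A B u" and u': "enriched_nat W X (self W) B A u'"
        and "r x = enat_comp W (self W) A B K s u x" "s x = enat_comp W (self W) B A K r u' x"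
        and x: "x \<in> EObj X" for A B r s u u' x
    proof -
      have fA: "enriched_functor W X (self W) A" and fB: "enriched_functor W X (self W) B"
        and fK: "enriched_functor W X (self W) K"
        using A B unfolding Monos_iff by simp_all
      have ux: "u x \<in> Hom W (unt W) (ihom W (EFO A x) (EFO B x))"
        and ux': "u' x \<in> Hom W (unt W) (ihom W (EFO B x) (EFO A x))"
        using u u' enriched_nat_self_iff[OF fA fB] enriched_nat_self_iff[OF fB fA] x by simp_all
      let ?u = "component A B u x" and ?u' = "component B A u' x" and ?r = "component A K r x"
      have c: "?u \<in> Hom W (EFO A x) (EFO B x)" "?u' \<in> Hom W (EFO B x) (EFO A x)"
        unfolding component_def in_Hom using fA fB ux ux' x by simp_all
      have "?r = component B K s x \<cdot> ?u"
        using component_enat_comp(1)[where s = u and t = s, OF fA fB fK x ux Monos_component(1)[OF B x]] that(5)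
        unfolding component_def by simp
      moreover have "component B K s x = ?r \<cdot> ?u'"
        using component_enat_comp(1)[where s = u' and t = r, OF fB fA fK x ux' Monos_component(1)[OF A x]] that(6)
        unfolding component_def by simp
      ultimately have "?r \<cdot> (?u' \<cdot> ?u) = ?r \<cdot> Idn W (EFO A x)"
        using c Monos_component[OF A x] unfolding in_Hom by (metis Comp_Idn_simp assoc)
      then have "?u' \<cdot> ?u = Idn W (EFO A x)"
        by (rule monicD[OF Monos_component(5)[OF A x], rotated -1])
          (use c Monos_component[OF A x] EFO_Obj[OF fA x] in \<open>simp_all add: in_Hom\<close>)
      then show ?thesis
        using component_enat_comp[where s = u and t = u', OF fA fB fA x ux ux'] EFO_Obj[OF fA x]
          arrow_of_inj[OF component_enat_comp(2)[where s = u and t = u', OF fA fB fA x ux ux'] EId_self_Hom[OF EFO_Obj[OF fA x]]]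
        unfolding component_def by simp
    qed
    have "enat_iso W X (self W) A B t"
      unfolding enat_iso_def
      using nat id[OF r s nat e e'] id[OF s r nat(2,1) e' e] by blast
    then show ?l using r s e unfolding mono_equiv_def by auto
  }
qed

lemma mono_equiv_eq: "mono_equiv W X K = preordered_set.eqv (Monos W X K) (mono_ge W X K)"
proof -
  have "mono_equiv W X K \<subseteq> Monos W X K \<times> Monos W X K" unfolding mono_equiv_def by auto
  then show ?thesis
    unfolding preordered_set.eqv_def[OF preordered_Monos] using mono_equiv_iff by fast
qed

lemma Sub_order_eq: "Sub_order W X K = preordered_set.quotient_order (Monos W X K) (mono_ge W X K)"
  unfolding Sub_order_def Sub_def preordered_set.quotient_order_def[OF preordered_Monos] mono_equiv_eq ..

end

section \<open>Base change along a monoidal adjunction\<close>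

locale monoidal_adjoint_pair =
  U: symmetric_monoidal_closed U + V: symmetric_monoidal_closed V
  for U :: "('u, 'g) smcc" and V :: "('v, 'f) smcc" +
  fixes F :: "('u, 'g, 'v, 'f) lax" and G :: "('v, 'f, 'u, 'g) lax"
    and eta :: "'u \<Rightarrow> 'g" and eps :: "'v \<Rightarrow> 'f"
  assumes adjunction: "monoidal_adjunction U V F G eta eps"
begin

lemma lax_G: "lax_monoidal V U G" and lax_F: "lax_monoidal U V F"
  using adjunction by (simp_all add: monoidal_adjunction_def)

lemma functor_G: "is_functor V U G" and functor_F: "is_functor U V F"
  using lax_G lax_F by (simp_all add: lax_monoidal_def)

lemma G_Obj [simp]: "x \<in> Obj V \<Longrightarrow> FO G x \<in> Obj U"
  and F_Obj [simp]: "y \<in> Obj U \<Longrightarrow> FO F y \<in> Obj V"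
  using functor_G functor_F by (simp_all add: is_functor_def)

lemma
  assumes "f \<in> Arr V"
  shows G_Arr [simp]: "FA G f \<in> Arr U" and Dom_G [simp]: "Dom U (FA G f) = FO G (Dom V f)"
    and Cod_G [simp]: "Cod U (FA G f) = FO G (Cod V f)"
proof -
  have "f \<in> Hom V (Dom V f) (Cod V f)" "Dom V f \<in> Obj V" "Cod V f \<in> Obj V"
    using assms by (simp_all add: in_Hom)
  then have "FA G f \<in> Hom U (FO G (Dom V f)) (FO G (Cod V f))"
    using functor_G unfolding is_functor_def by blast
  then show "FA G f \<in> Arr U" "Dom U (FA G f) = FO G (Dom V f)" "Cod U (FA G f) = FO G (Cod V f)"
    by (simp_all add: in_Hom)
qed

lemma
  assumes "f \<in> Arr U"
  shows F_Arr [simp]: "FA F f \<in> Arr V" and Dom_F [simp]: "Dom V (FA F f) = FO F (Dom U f)"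
    and Cod_F [simp]: "Cod V (FA F f) = FO F (Cod U f)"
proof -
  have "f \<in> Hom U (Dom U f) (Cod U f)" "Dom U f \<in> Obj U" "Cod U f \<in> Obj U"
    using assms by (simp_all add: in_Hom)
  then have "FA F f \<in> Hom V (FO F (Dom U f)) (FO F (Cod U f))"
    using functor_F unfolding is_functor_def by blast
  then show "FA F f \<in> Arr V" "Dom V (FA F f) = FO F (Dom U f)" "Cod V (FA F f) = FO F (Cod U f)"
    by (simp_all add: in_Hom)
qed

lemma G_Idn [simp]: "x \<in> Obj V \<Longrightarrow> FA G (Idn V x) = Idn U (FO G x)"
  using functor_G by (simp add: is_functor_def)

lemma G_Comp:
  assumes "f \<in> Arr V" "g \<in> Arr V" "Dom V g = Cod V f"
  shows "FA G (g \<cdot>\<^bsub>V\<^esub> f) = FA G g \<cdot>\<^bsub>U\<^esub> FA G f"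
proof -
  have "f \<in> Hom V (Dom V f) (Cod V f)" "g \<in> Hom V (Cod V f) (Cod V g)"
    "Dom V f \<in> Obj V" "Cod V f \<in> Obj V" "Cod V g \<in> Obj V"
    using assms by (simp_all add: in_Hom)
  then show ?thesis using functor_G unfolding is_functor_def by blast
qed

lemma F_Comp:
  assumes "f \<in> Arr U" "g \<in> Arr U" "Dom U g = Cod U f"
  shows "FA F (g \<cdot>\<^bsub>U\<^esub> f) = FA F g \<cdot>\<^bsub>V\<^esub> FA F f"
proof -
  have "f \<in> Hom U (Dom U f) (Cod U f)" "g \<in> Hom U (Cod U f) (Cod U g)"
    "Dom U f \<in> Obj U" "Cod U f \<in> Obj U" "Cod U g \<in> Obj U"
    using assms by (simp_all add: in_Hom)
  then show ?thesis using functor_F unfolding is_functor_def by blast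
qed

lemma lu_Arr [simp]: "lu G \<in> Arr U" and Dom_lu [simp]: "Dom U (lu G) = unt U"
  and Cod_lu [simp]: "Cod U (lu G) = FO G (unt V)"
  using lax_G by (simp_all add: lax_monoidal_def in_Hom)

lemma
  assumes "a \<in> Obj V" "b \<in> Obj V"
  shows lm_Arr [simp]: "lm G a b \<in> Arr U"
    and Dom_lm [simp]: "Dom U (lm G a b) = FO G a \<odot>\<^bsub>U\<^esub> FO G b"
    and Cod_lm [simp]: "Cod U (lm G a b) = FO G (a \<odot>\<^bsub>V\<^esub> b)"
proof -
  have "lm G a b \<in> Hom U (FO G a \<odot>\<^bsub>U\<^esub> FO G b) (FO G (a \<odot>\<^bsub>V\<^esub> b))"
    using lax_G assms unfolding lax_monoidal_def by blast
  then show "lm G a b \<in> Arr U" "Dom U (lm G a b) = FO G a \<odot>\<^bsub>U\<^esub> FO G b"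
    "Cod U (lm G a b) = FO G (a \<odot>\<^bsub>V\<^esub> b)"
    by (simp_all add: in_Hom)
qed

lemma lm_natural:
  assumes "f \<in> Arr V" "g \<in> Arr V"
  shows "lm G (Cod V f) (Cod V g) \<cdot>\<^bsub>U\<^esub> (FA G f \<otimes>\<^bsub>U\<^esub> FA G g)
    = FA G (f \<otimes>\<^bsub>V\<^esub> g) \<cdot>\<^bsub>U\<^esub> lm G (Dom V f) (Dom V g)"
proof -
  have "f \<in> Hom V (Dom V f) (Cod V f)" "g \<in> Hom V (Dom V g) (Cod V g)"
    "Dom V f \<in> Obj V" "Cod V f \<in> Obj V" "Dom V g \<in> Obj V" "Cod V g \<in> Obj V"
    using assms by (simp_all add: in_Hom)
  then show ?thesis using lax_G unfolding lax_monoidal_def by blast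
qed

lemma lm_assoc:
  assumes "a \<in> Obj V" "b \<in> Obj V" "c \<in> Obj V"
  shows "FA G (asc V a b c) \<cdot>\<^bsub>U\<^esub> lm G (a \<odot>\<^bsub>V\<^esub> b) c \<cdot>\<^bsub>U\<^esub> (lm G a b \<otimes>\<^bsub>U\<^esub> Idn U (FO G c))
    = lm G a (b \<odot>\<^bsub>V\<^esub> c) \<cdot>\<^bsub>U\<^esub> (Idn U (FO G a) \<otimes>\<^bsub>U\<^esub> lm G b c)
        \<cdot>\<^bsub>U\<^esub> asc U (FO G a) (FO G b) (FO G c)"
  using lax_G assms unfolding lax_monoidal_def by blast

text \<open>Applying \<open>G\<close> to an arrow out of a tensor product and restricting along the coherence arrow; this is
  how \<open>G\<close> transports actions.  The laws below restate the lax monoidal axioms in this form.\<close>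

definition lax_image :: "'v \<Rightarrow> 'v \<Rightarrow> 'f \<Rightarrow> 'g" where
  "lax_image a b h = FA G h \<cdot>\<^bsub>U\<^esub> lm G a b"

lemma
  assumes "a \<in> Obj V" "b \<in> Obj V" "h \<in> Arr V" "Dom V h = a \<odot>\<^bsub>V\<^esub> b"
  shows lax_image_Arr [simp]: "lax_image a b h \<in> Arr U"
    and Dom_lax_image [simp]: "Dom U (lax_image a b h) = FO G a \<odot>\<^bsub>U\<^esub> FO G b"
    and Cod_lax_image [simp]: "Cod U (lax_image a b h) = FO G (Cod V h)"
  unfolding lax_image_def using assms by simp_all

lemma lax_image_lun: "a \<in> Obj V
    \<Longrightarrow> lax_image (unt V) a (lun V a) \<cdot>\<^bsub>U\<^esub> (lu G \<otimes>\<^bsub>U\<^esub> Idn U (FO G a)) = lun U (FO G a)"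
  and lax_image_run: "a \<in> Obj V
    \<Longrightarrow> lax_image a (unt V) (run V a) \<cdot>\<^bsub>U\<^esub> (Idn U (FO G a) \<otimes>\<^bsub>U\<^esub> lu G) = run U (FO G a)"
  using lax_G unfolding lax_monoidal_def lax_image_def by blast+

lemma lax_image_tensA:
  assumes "f \<in> Arr V" "g \<in> Arr V" "h \<in> Arr V" "Dom V h = Cod V f \<odot>\<^bsub>V\<^esub> Cod V g"
  shows "lax_image (Cod V f) (Cod V g) h \<cdot>\<^bsub>U\<^esub> (FA G f \<otimes>\<^bsub>U\<^esub> FA G g)
    = lax_image (Dom V f) (Dom V g) (h \<cdot>\<^bsub>V\<^esub> (f \<otimes>\<^bsub>V\<^esub> g))"
  unfolding lax_image_def using assms lm_natural[OF assms(1,2)] by (simp add: G_Comp)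

lemma lax_image_tensA_left:
  assumes "f \<in> Arr V" "b \<in> Obj V" "h \<in> Arr V" "Dom V h = Cod V f \<odot>\<^bsub>V\<^esub> b"
  shows "lax_image (Cod V f) b h \<cdot>\<^bsub>U\<^esub> (FA G f \<otimes>\<^bsub>U\<^esub> Idn U (FO G b))
    = lax_image (Dom V f) b (h \<cdot>\<^bsub>V\<^esub> (f \<otimes>\<^bsub>V\<^esub> Idn V b))"
  using lax_image_tensA[of f "Idn V b" h] assms by simp

lemma lax_image_tensA_right:
  assumes "g \<in> Arr V" "a \<in> Obj V" "h \<in> Arr V" "Dom V h = a \<odot>\<^bsub>V\<^esub> Cod V g"
  shows "lax_image a (Cod V g) h \<cdot>\<^bsub>U\<^esub> (Idn U (FO G a) \<otimes>\<^bsub>U\<^esub> FA G g)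
    = lax_image a (Dom V g) (h \<cdot>\<^bsub>V\<^esub> (Idn V a \<otimes>\<^bsub>V\<^esub> g))"
  using lax_image_tensA[of "Idn V a" g h] assms by simp

lemma G_lax_image:
  assumes "a \<in> Obj V" "b \<in> Obj V" "h \<in> Arr V" "Dom V h = a \<odot>\<^bsub>V\<^esub> b" "f \<in> Arr V" "Dom V f = Cod V h"
  shows "FA G f \<cdot>\<^bsub>U\<^esub> lax_image a b h = lax_image a b (f \<cdot>\<^bsub>V\<^esub> h)"
  unfolding lax_image_def using assms by (simp add: G_Comp)

lemma
  assumes "x \<in> Obj U"
  shows eta_Arr [simp]: "eta x \<in> Arr U" and Dom_eta [simp]: "Dom U (eta x) = x"
    and Cod_eta [simp]: "Cod U (eta x) = FO G (FO F x)"
  using adjunction assms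
  by (simp_all add: monoidal_adjunction_def monoidal_nat_def lax_id_def lax_comp_def in_Hom)

lemma
  assumes "y \<in> Obj V"
  shows eps_Arr [simp]: "eps y \<in> Arr V" and Dom_eps [simp]: "Dom V (eps y) = FO F (FO G y)"
    and Cod_eps [simp]: "Cod V (eps y) = y"
    and G_eps_eta: "FA G (eps y) \<cdot>\<^bsub>U\<^esub> eta (FO G y) = Idn U (FO G y)"
  using adjunction assms
  by (simp_all add: monoidal_adjunction_def monoidal_nat_def lax_id_def lax_comp_def in_Hom)

lemma eta_natural: 
  assumes "f \<in> Arr U"
  shows "eta (Cod U f) \<cdot>\<^bsub>U\<^esub> f = FA G (FA F f) \<cdot>\<^bsub>U\<^esub> eta (Dom U f)"
proof -
  have "f \<in> Hom U (Dom U f) (Cod U f)" "Dom U f \<in> Obj U" "Cod U f \<in> Obj U"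
    using assms by (simp_all add: in_Hom)
  moreover have "monoidal_nat U U (lax_id U) (lax_comp U G F) eta"
    using adjunction by (simp add: monoidal_adjunction_def)
  ultimately show ?thesis unfolding monoidal_nat_def lax_id_def lax_comp_def by simp
qed

lemma eps_natural: 
  assumes "f \<in> Arr V"
  shows "eps (Cod V f) \<cdot>\<^bsub>V\<^esub> FA F (FA G f) = f \<cdot>\<^bsub>V\<^esub> eps (Dom V f)"
proof -
  have "f \<in> Hom V (Dom V f) (Cod V f)" "Dom V f \<in> Obj V" "Cod V f \<in> Obj V"
    using assms by (simp_all add: in_Hom)
  moreover have "monoidal_nat V V (lax_comp V F G) (lax_id V) eps"
    using adjunction by (simp add: monoidal_adjunction_def)
  ultimately show ?thesis unfolding monoidal_nat_def lax_id_def lax_comp_def by simp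
qed

text \<open>The arrow \<open>eps y \<cdot> F g\<close> is the adjoint transpose of \<open>g\<close>; the triangle identity at \<open>y\<close> recovers
  \<open>g\<close> from it.\<close>

lemma transpose_retract:
  assumes "g \<in> Arr U" "y \<in> Obj V" "Cod U g = FO G y"
  shows "FA G (eps y \<cdot>\<^bsub>V\<^esub> FA F g) \<cdot>\<^bsub>U\<^esub> eta (Dom U g) = g"
proof -
  have "FA G (eps y \<cdot>\<^bsub>V\<^esub> FA F g) \<cdot>\<^bsub>U\<^esub> eta (Dom U g)
      = FA G (eps y) \<cdot>\<^bsub>U\<^esub> (FA G (FA F g) \<cdot>\<^bsub>U\<^esub> eta (Dom U g))"
    using assms by (simp add: G_Comp)
  also have "\<dots> = (FA G (eps y) \<cdot>\<^bsub>U\<^esub> eta (FO G y)) \<cdot>\<^bsub>U\<^esub> g"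
    using eta_natural[OF assms(1)] assms by simp
  also have "\<dots> = g" unfolding G_eps_eta[OF assms(2)] using assms by simp
  finally show ?thesis .
qed

text \<open>Transposition along the adjunction is natural: transposing \<open>G f \<cdot> g\<close> composes the transpose of \<open>g\<close>
  with \<open>f\<close>.\<close>

lemma Comp_eps_F:
  assumes f: "f \<in> Arr V" and g: "g \<in> Arr U" "Cod U g = FO G (Dom V f)"
  shows "f \<cdot>\<^bsub>V\<^esub> (eps (Dom V f) \<cdot>\<^bsub>V\<^esub> FA F g) = eps (Cod V f) \<cdot>\<^bsub>V\<^esub> FA F (FA G f \<cdot>\<^bsub>U\<^esub> g)"
proof -
  have "f \<cdot>\<^bsub>V\<^esub> (eps (Dom V f) \<cdot>\<^bsub>V\<^esub> FA F g) = (f \<cdot>\<^bsub>V\<^esub> eps (Dom V f)) \<cdot>\<^bsub>V\<^esub> FA F g"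
    using f g by simp
  also have "\<dots> = eps (Cod V f) \<cdot>\<^bsub>V\<^esub> FA F (FA G f \<cdot>\<^bsub>U\<^esub> g)"
    unfolding eps_natural[OF f, symmetric] using f g by (simp add: F_Comp)
  finally show ?thesis .
qed

text \<open>The reason is the adjunction: arrows into \<open>G (Dom f)\<close> are compared through their transposes, where
  \<open>f\<close> itself can be cancelled.\<close>

lemma G_preserves_monic:
  assumes m: "monic V f"
  shows "monic U (FA G f)"
proof (rule U.monicI)
  have f: "f \<in> Arr V" using m by (simp add: monic_def)
  then show "FA G f \<in> Arr U" by simp
  fix g h assume gh: "g \<in> Arr U" "h \<in> Arr U" "Dom U g = Dom U h"
    "Cod U g = Dom U (FA G f)" "Cod U h = Dom U (FA G f)" and e: "FA G f \<cdot>\<^bsub>U\<^esub> g = FA G f \<cdot>\<^bsub>U\<^esub> h"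
  let ?t = "\<lambda>g. eps (Dom V f) \<cdot>\<^bsub>V\<^esub> FA F g"
  have "f \<cdot>\<^bsub>V\<^esub> ?t g = f \<cdot>\<^bsub>V\<^esub> ?t h" using Comp_eps_F f gh e by simp
  then have t: "?t g = ?t h"
    by (rule V.monicD[OF m, rotated -1]) (use f gh in simp_all)
  have "g = FA G (?t g) \<cdot>\<^bsub>U\<^esub> eta (Dom U g)"
    by (rule transpose_retract[symmetric]) (use f gh in simp_all)
  also have "\<dots> = FA G (?t h) \<cdot>\<^bsub>U\<^esub> eta (Dom U h)" unfolding t gh(3) ..
  also have "\<dots> = h" by (rule transpose_retract) (use f gh in simp_all)
  finally show "g = h" .
qed

text \<open>Let \<open>p\<close> and \<open>q\<close> be the pullback of \<open>r\<close> and \<open>s\<close>.  It suffices that \<open>p\<close> is an isomorphism, as then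
  \<open>q \<cdot> inv_arr V p\<close> is the factor.  Since \<open>G\<close> is conservative, this can be checked for \<open>G p\<close>, which is
  monic; so only a section of \<open>G p\<close> has to be found.  It is the transpose of the arrow from
  \<open>F G (Dom r)\<close> into the pullback that the counit at \<open>Dom r\<close> and the transpose of \<open>u\<close> induce.\<close>

lemma G_reflects_factorization:
  assumes pullbacks: "\<And>f g. \<lbrakk>f \<in> Arr V; g \<in> Arr V; Cod V f = Cod V g\<rbrakk> \<Longrightarrow> \<exists>p q. is_pullback V f g p q"
    and cons: "conservative V U G"
    and r: "r \<in> Arr V" and s: "monic V s" and cod: "Cod V r = Cod V s"
    and u: "u \<in> Hom U (FO G (Dom V r)) (FO G (Dom V s))" and e: "FA G s \<cdot>\<^bsub>U\<^esub> u = FA G r"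
  shows "\<exists>t\<in>Hom V (Dom V r) (Dom V s). s \<cdot>\<^bsub>V\<^esub> t = r"
proof -
  have s': "s \<in> Arr V" using s by (simp add: monic_def)
  obtain p q where pb: "is_pullback V r s p q" using pullbacks[OF r s' cod] by blast
  then have pq: "p \<in> Arr V" "q \<in> Arr V" "Cod V p = Dom V r" "Cod V q = Dom V s" "Dom V q = Dom V p"
    and rp: "r \<cdot>\<^bsub>V\<^esub> p = s \<cdot>\<^bsub>V\<^esub> q"
    by (auto simp: is_pullback_def in_Hom)
  have u': "u \<in> Arr U" "Dom U u = FO G (Dom V r)" "Cod U u = FO G (Dom V s)"
    using u by (simp_all add: in_Hom)
  let ?a = "eps (Dom V r)" and ?b = "eps (Dom V s) \<cdot>\<^bsub>V\<^esub> FA F u"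
  have "r \<cdot>\<^bsub>V\<^esub> ?a = s \<cdot>\<^bsub>V\<^esub> ?b"
    using Comp_eps_F[OF s' u'(1,3)] eps_natural[OF r] e cod by simp
  then obtain k where k: "k \<in> Arr V" "Dom V k = FO F (FO G (Dom V r))" "Cod V k = Dom V p" "p \<cdot>\<^bsub>V\<^esub> k = ?a"
    using V.pullback_universal[OF pb, of ?a ?b] r s' u' by (auto simp: in_Hom)
  let ?h = "FA G k \<cdot>\<^bsub>U\<^esub> eta (FO G (Dom V r))"
  have "FA G p \<cdot>\<^bsub>U\<^esub> ?h = FA G (p \<cdot>\<^bsub>V\<^esub> k) \<cdot>\<^bsub>U\<^esub> eta (FO G (Dom V r))"
    using pq k(1-3) r by (simp add: G_Comp)
  then have split: "FA G p \<cdot>\<^bsub>U\<^esub> ?h = Idn U (FO G (Dom V r))"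
    unfolding k(4) using G_eps_eta r by simp
  have "monic U (FA G p)"
    by (rule G_preserves_monic[OF V.pullback_of_monic_is_monic[OF pb s]])
  then have "is_iso U (FA G p)"
    by (rule U.monic_split_epi_is_iso[where h = ?h]) (use split pq k r in simp_all)
  then have iso: "is_iso V p" using cons pq unfolding conservative_def by blast
  let ?t = "q \<cdot>\<^bsub>V\<^esub> inv_arr V p"
  have "s \<cdot>\<^bsub>V\<^esub> ?t = (s \<cdot>\<^bsub>V\<^esub> q) \<cdot>\<^bsub>V\<^esub> inv_arr V p" using s' pq iso by simp
  also have "\<dots> = r" unfolding rp[symmetric] using r pq iso by simp
  finally show ?thesis using pq iso by (auto simp: in_Hom)
qed

section \<open>The action of a lifted functor\<close>

text \<open>The unit coherence of \<open>G\<close> absorbs the unitor, so base change commutes with precomposition.\<close>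

lemma precomp_base_change:
  assumes hom: "EHom X b c \<in> Obj V"
    and comp: "EComp X a b c \<in> Hom V (EHom X b c \<odot>\<^bsub>V\<^esub> EHom X a b) (EHom X a c)"
    and n: "n \<in> Hom V (unt V) (EHom X a b)"
  shows "precomp U (base_change_cat U G X) a b c (kmap U G n) = FA G (precomp V X a b c n)"
proof -
  let ?h = "EHom X b c"
  note t = hom comp[unfolded in_Hom] n[unfolded in_Hom]
  have ab: "EHom X a b \<in> Obj V" using V.Obj_Cod[of n] t by simp
  have "precomp U (base_change_cat U G X) a b c (kmap U G n)
      = lax_image ?h (EHom X a b) (EComp X a b c) \<cdot>\<^bsub>U\<^esub> (Idn U (FO G ?h) \<otimes>\<^bsub>U\<^esub> FA G n)
          \<cdot>\<^bsub>U\<^esub> (Idn U (FO G ?h) \<otimes>\<^bsub>U\<^esub> lu G) \<cdot>\<^bsub>U\<^esub> inv_arr U (run U (FO G ?h))"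
    unfolding precomp_def base_change_cat_def kmap_def lax_image_def using t ab by simp
  also have "lax_image ?h (EHom X a b) (EComp X a b c) \<cdot>\<^bsub>U\<^esub> (Idn U (FO G ?h) \<otimes>\<^bsub>U\<^esub> FA G n)
      = lax_image ?h (unt V) (EComp X a b c \<cdot>\<^bsub>V\<^esub> (Idn V ?h \<otimes>\<^bsub>V\<^esub> n))"
    using lax_image_tensA_right[of n ?h "EComp X a b c"] t by simp
  \<comment> \<open>Splitting off the right unitor of \<open>V\<close> makes room for the unit coherence of \<open>G\<close>.\<close>
  also have "EComp X a b c \<cdot>\<^bsub>V\<^esub> (Idn V ?h \<otimes>\<^bsub>V\<^esub> n) = precomp V X a b c n \<cdot>\<^bsub>V\<^esub> run V ?h"
    unfolding precomp_def using t ab by simp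
  also have "lax_image ?h (unt V) \<dots> = FA G (precomp V X a b c n) \<cdot>\<^bsub>U\<^esub> lax_image ?h (unt V) (run V ?h)"
    unfolding precomp_def using t ab by (subst G_lax_image) simp_all
  also have "\<dots> \<cdot>\<^bsub>U\<^esub> (Idn U (FO G ?h) \<otimes>\<^bsub>U\<^esub> lu G) \<cdot>\<^bsub>U\<^esub> inv_arr U (run U (FO G ?h))
      = FA G (precomp V X a b c n)
        \<cdot>\<^bsub>U\<^esub> (lax_image ?h (unt V) (run V ?h) \<cdot>\<^bsub>U\<^esub> (Idn U (FO G ?h) \<otimes>\<^bsub>U\<^esub> lu G))
        \<cdot>\<^bsub>U\<^esub> inv_arr U (run U (FO G ?h))"
    unfolding precomp_def using t ab by simp
  also have "\<dots> = FA G (precomp V X a b c n)"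
    unfolding lax_image_run[OF hom] precomp_def using t ab by simp
  finally show ?thesis .
qed

text \<open>By definition the hom-arrow of \<open>G\<^sup>U\<close> precomposes with the counit and then transposes along
  the unit.  Moving the counit through the evaluation and the coherence arrow brings it next to the
  unit, where a triangle identity cancels both and leaves \<open>G(ev) \<cdot> m\<close>.\<close>

lemma
  assumes obj: "a \<in> Obj V" "b \<in> Obj V"
  shows GU_Hom: "EFA (GU U V F G eta eps) a b \<in> Hom U (FO G (ihom V a b)) (ihom U (FO G a) (FO G b))"
    and uncurry_GU: "U.uncurry (FO G a) (FO G b) (EFA (GU U V F G eta eps) a b)
      = lax_image (ihom V a b) a (ev V a b)"
proof -
  let ?x = "FO G a" and ?fx = "FO F (FO G a)"
  let ?pre = "precomp V (self V) ?fx a b (name_of V ?fx a (eps a))"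
  have x: "?x \<in> Obj U" and fx: "?fx \<in> Obj V" using obj by simp_all
  have n: "name_of V ?fx a (eps a) \<in> Hom V (unt V) (ihom V ?fx a)"
    using obj by (intro V.name_of_Hom) simp_all
  have pre: "?pre \<in> Arr V" "Dom V ?pre = ihom V a b" "Cod V ?pre = ihom V ?fx b"
    unfolding precomp_def using obj fx n by (simp_all add: in_Hom)
  have upre: "V.uncurry ?fx b ?pre = ev V a b \<cdot>\<^bsub>V\<^esub> (Idn V (ihom V a b) \<otimes>\<^bsub>V\<^esub> eps a)"
    using V.uncurry_precomp[OF fx obj, of "eps a"] obj by simp
  let ?i = "Idn U (FO G (ihom V ?fx b))" and ?j = "Idn U (FO G (ihom V a b))"
  let ?phi = "Phi U V F G eta ?x b"
  have phi: "?phi = curry U (FO G (ihom V ?fx b)) ?x (FO G b)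
      (lax_image (ihom V ?fx b) ?fx (ev V ?fx b) \<cdot>\<^bsub>U\<^esub> (?i \<otimes>\<^bsub>U\<^esub> eta ?x))"
    unfolding Phi_def lax_image_def by simp
  have phi': "?phi \<in> Arr U" "Dom U ?phi = FO G (ihom V ?fx b)" "Cod U ?phi = ihom U ?x (FO G b)"
    and uphi: "U.uncurry ?x (FO G b) ?phi
      = lax_image (ihom V ?fx b) ?fx (ev V ?fx b) \<cdot>\<^bsub>U\<^esub> (?i \<otimes>\<^bsub>U\<^esub> eta ?x)"
    unfolding phi using obj x fx by simp_all
  have GU: "EFA (GU U V F G eta eps) a b = ?phi \<cdot>\<^bsub>U\<^esub> FA G ?pre"
    unfolding GU_def using precomp_base_change[of "self V" a b ?fx] obj fx n by (simp add: in_Hom)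
  show "EFA (GU U V F G eta eps) a b \<in> Hom U (FO G (ihom V a b)) (ihom U ?x (FO G b))"
    unfolding GU in_Hom using pre phi' by simp
  have "U.uncurry ?x (FO G b) (EFA (GU U V F G eta eps) a b)
      = lax_image (ihom V ?fx b) ?fx (ev V ?fx b) \<cdot>\<^bsub>U\<^esub> (?i \<otimes>\<^bsub>U\<^esub> eta ?x)
          \<cdot>\<^bsub>U\<^esub> (FA G ?pre \<otimes>\<^bsub>U\<^esub> Idn U ?x)"
    unfolding GU uphi[symmetric] using pre phi' obj x by (intro U.uncurry_Comp) simp_all
  \<comment> \<open>The unit and the counit act on different tensor factors, so they can be interchanged.\<close>
  also have "\<dots> = lax_image (ihom V ?fx b) ?fx (ev V ?fx b)
      \<cdot>\<^bsub>U\<^esub> (FA G ?pre \<otimes>\<^bsub>U\<^esub> Idn U (FO G ?fx)) \<cdot>\<^bsub>U\<^esub> (?j \<otimes>\<^bsub>U\<^esub> eta ?x)"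
    using obj x fx pre by simp
  also have "lax_image (ihom V ?fx b) ?fx (ev V ?fx b) \<cdot>\<^bsub>U\<^esub> (FA G ?pre \<otimes>\<^bsub>U\<^esub> Idn U (FO G ?fx))
      = lax_image (ihom V a b) ?fx (V.uncurry ?fx b ?pre)"
    using lax_image_tensA_left[of ?pre ?fx "ev V ?fx b"] obj fx pre unfolding V.uncurry_def by simp
  also have "\<dots> = lax_image (ihom V a b) a (ev V a b) \<cdot>\<^bsub>U\<^esub> (?j \<otimes>\<^bsub>U\<^esub> FA G (eps a))"
    unfolding upre using lax_image_tensA_right[of "eps a" "ihom V a b" "ev V a b"] obj by simp
  also have "\<dots> \<cdot>\<^bsub>U\<^esub> (?j \<otimes>\<^bsub>U\<^esub> eta ?x) = lax_image (ihom V a b) a (ev V a b)"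
    using obj x fx by (simp add: G_eps_eta)
  finally show "U.uncurry ?x (FO G b) (EFA (GU U V F G eta eps) a b)
      = lax_image (ihom V a b) a (ev V a b)" .
qed

lemma
  assumes obj: "a \<in> Obj V" "b \<in> Obj V" and g: "g \<in> Arr V" "Cod V g = ihom V a b"
  shows GU_Comp_Hom: "EFA (GU U V F G eta eps) a b \<cdot>\<^bsub>U\<^esub> FA G g \<in> Hom U (FO G (Dom V g)) (ihom U (FO G a) (FO G b))"
    and uncurry_GU_Comp: "U.uncurry (FO G a) (FO G b) (EFA (GU U V F G eta eps) a b \<cdot>\<^bsub>U\<^esub> FA G g)
      = lax_image (Dom V g) a (V.uncurry a b g)"
proof -
  note GU = GU_Hom[OF obj, unfolded in_Hom]
  show "EFA (GU U V F G eta eps) a b \<cdot>\<^bsub>U\<^esub> FA G g \<in> Hom U (FO G (Dom V g)) (ihom U (FO G a) (FO G b))"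
    using GU g by (simp add: in_Hom)
  have "U.uncurry (FO G a) (FO G b) (EFA (GU U V F G eta eps) a b \<cdot>\<^bsub>U\<^esub> FA G g)
      = lax_image (ihom V a b) a (ev V a b) \<cdot>\<^bsub>U\<^esub> (FA G g \<otimes>\<^bsub>U\<^esub> Idn U (FO G a))"
    using GU g obj uncurry_GU[OF obj] by (simp add: U.uncurry_Comp)
  also have "\<dots> = lax_image (Dom V g) a (V.uncurry a b g)"
    using lax_image_tensA_left[of g a "ev V a b"] g obj unfolding V.uncurry_def by simp
  finally show "U.uncurry (FO G a) (FO G b) (EFA (GU U V F G eta eps) a b \<cdot>\<^bsub>U\<^esub> FA G g)
      = lax_image (Dom V g) a (V.uncurry a b g)" .
qed

abbreviation "lift \<equiv> Gtilde U V F G eta eps"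
abbreviation "lift_nat \<equiv> Gtilde_nat U V F G eta eps"

lemma EFO_Gtilde [simp]: "EFO (lift A) x = FO G (EFO A x)"
  by (simp add: Gtilde_def efun_comp_def GU_def base_change_fun_def)

lemma base_change_cat_simps [simp]:
  "EObj (base_change_cat U G X) = EObj X" "EHom (base_change_cat U G X) x y = FO G (EHom X x y)"
  by (simp_all add: base_change_cat_def)

lemma
  assumes A: "enriched_functor V X (self V) A" and x: "x \<in> EObj X" and y: "y \<in> EObj X"
  shows EFA_Gtilde_Hom: "EFA (lift A) x y \<in> Hom U (FO G (EHom X x y)) (ihom U (FO G (EFO A x)) (FO G (EFO A y)))"
    and action_Gtilde: "U.action (lift A) x y = lax_image (EHom X x y) (EFO A x) (V.action A x y)"
proof -
  have eq: "EFA (lift A) x y = EFA (GU U V F G eta eps) (EFO A x) (EFO A y) \<cdot>\<^bsub>U\<^esub> FA G (EFA A x y)"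
    by (simp add: Gtilde_def efun_comp_def base_change_fun_def)
  note t = V.EFO_Obj[OF A x] V.EFO_Obj[OF A y] V.EFA_Hom[OF A x y, unfolded in_Hom]
  show "EFA (lift A) x y \<in> Hom U (FO G (EHom X x y)) (ihom U (FO G (EFO A x)) (FO G (EFO A y)))"
    unfolding eq using GU_Comp_Hom[of "EFO A x" "EFO A y" "EFA A x y"] t by simp
  show "U.action (lift A) x y = lax_image (EHom X x y) (EFO A x) (V.action A x y)"
    unfolding U.action_def V.action_def eq EFO_Gtilde
    using uncurry_GU_Comp[of "EFO A x" "EFO A y" "EFA A x y"] t by simp
qed

lemma
  assumes A: "enriched_functor V X (self V) A" and B: "enriched_functor V X (self V) B"
    and x: "x \<in> EObj X" and tx: "t x \<in> Hom V (unt V) (ihom V (EFO A x) (EFO B x))"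
  shows Gtilde_nat_Hom: "lift_nat A B t x \<in> Hom U (unt U) (ihom U (FO G (EFO A x)) (FO G (EFO B x)))"
    and component_Gtilde_nat: "U.component (lift A) (lift B) (lift_nat A B t) x = FA G (V.component A B t x)"
proof -
  let ?a = "EFO A x" and ?b = "EFO B x" and ?c = "V.component A B t x"
  note t = V.EFO_Obj[OF A x] V.EFO_Obj[OF B x] tx[unfolded in_Hom]
  note c = V.component_Arr[where t = t, OF A B tx x] V.Dom_component[where t = t, OF A B tx x]
    V.Cod_component[where t = t, OF A B tx x]
  note h = GU_Comp_Hom[of ?a ?b "t x", unfolded in_Hom] uncurry_GU_Comp[of ?a ?b "t x"]
  have eq: "lift_nat A B t x = (EFA (GU U V F G eta eps) ?a ?b \<cdot>\<^bsub>U\<^esub> FA G (t x)) \<cdot>\<^bsub>U\<^esub> lu G"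
    unfolding Gtilde_nat_def kmap_def using t GU_Hom[of ?a ?b] by (simp add: in_Hom)
  show "lift_nat A B t x \<in> Hom U (unt U) (ihom U (FO G ?a) (FO G ?b))"
    unfolding eq in_Hom using h t by simp
  have "U.uncurry (FO G ?a) (FO G ?b) (lift_nat A B t x)
      = lax_image (unt V) ?a (V.uncurry ?a ?b (t x)) \<cdot>\<^bsub>U\<^esub> (lu G \<otimes>\<^bsub>U\<^esub> Idn U (FO G ?a))"
    unfolding eq using h t by (subst U.uncurry_Comp) simp_all
  also have "V.uncurry ?a ?b (t x) = ?c \<cdot>\<^bsub>V\<^esub> lun V ?a"
    unfolding V.component_def using tx t by (simp add: V.uncurry_name)
  also have "lax_image (unt V) ?a \<dots> = FA G ?c \<cdot>\<^bsub>U\<^esub> lax_image (unt V) ?a (lun V ?a)"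
    using t c by (simp add: G_lax_image)
  also have "\<dots> \<cdot>\<^bsub>U\<^esub> (lu G \<otimes>\<^bsub>U\<^esub> Idn U (FO G ?a)) = FA G ?c \<cdot>\<^bsub>U\<^esub> lun U (FO G ?a)"
    using t c lax_image_lun[of ?a] by simp
  finally show "U.component (lift A) (lift B) (lift_nat A B t) x = FA G ?c"
    unfolding U.component_def U.arrow_of_def EFO_Gtilde using t c by simp
qed

text \<open>The module laws of the lifted action are the images under \<open>G\<close> of those of \<open>A\<close>, combined with the
  unit and associativity coherence of \<open>G\<close>.\<close>

lemma enriched_functor_Gtilde:
  assumes X: "V.enriched_data X" and A: "enriched_functor V X (self V) A"
  shows "enriched_functor U (base_change_cat U G X) (self U) (lift A)"
proof -
  let ?GX = "base_change_cat U G X"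
  note EId = V.enriched_dataD(1)[OF X] and EComp = V.enriched_dataD(2)[OF X]
  have EId_G: "EId ?GX x = FA G (EId X x) \<cdot>\<^bsub>U\<^esub> lu G" for x by (simp add: base_change_cat_def)
  have EComp_G: "EComp ?GX x y z = lax_image (EHom X y z) (EHom X x y) (EComp X x y z)" for x y z
    by (simp add: base_change_cat_def lax_image_def)
  note obj = V.EFO_Obj[OF A] V.EHom_Obj[OF A]
  note act = V.action_Arr[OF A] V.Dom_action[OF A] V.Cod_action[OF A]
  have "V.action A x x \<cdot>\<^bsub>V\<^esub> (EId X x \<otimes>\<^bsub>V\<^esub> Idn V (EFO A x)) = lun V (EFO A x)"
    if "x \<in> EObj X" for x
    using A V.enriched_functor_self_iff[OF X, of A] obj V.EFA_Hom[OF A] that by simp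
  note unit_law = this
  have "V.action A x z \<cdot>\<^bsub>V\<^esub> (EComp X x y z \<otimes>\<^bsub>V\<^esub> Idn V (EFO A x))
      = V.action A y z \<cdot>\<^bsub>V\<^esub> (Idn V (EHom X y z) \<otimes>\<^bsub>V\<^esub> V.action A x y)
          \<cdot>\<^bsub>V\<^esub> asc V (EHom X y z) (EHom X x y) (EFO A x)"
    if "x \<in> EObj X" "y \<in> EObj X" "z \<in> EObj X" for x y z
    using A V.enriched_functor_self_iff[OF X, of A] obj V.EFA_Hom[OF A] that by simp
  note comp_law = this
  have GX: "U.enriched_data ?GX"
    unfolding U.enriched_data_def EId_G EComp_G base_change_cat_simps in_Hom
  proof (intro conjI ballI)
    fix x assume x: "x \<in> EObj X"
    show "FA G (EId X x) \<cdot>\<^bsub>U\<^esub> lu G \<in> Arr U" "Dom U (FA G (EId X x) \<cdot>\<^bsub>U\<^esub> lu G) = unt U"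
      "Cod U (FA G (EId X x) \<cdot>\<^bsub>U\<^esub> lu G) = FO G (EHom X x x)"
      using EId[OF x] by (simp_all add: in_Hom)
    fix y z assume y: "y \<in> EObj X" and z: "z \<in> EObj X"
    let ?m = "lax_image (EHom X y z) (EHom X x y) (EComp X x y z)"
    show "?m \<in> Arr U" "Dom U ?m = FO G (EHom X y z) \<odot>\<^bsub>U\<^esub> FO G (EHom X x y)"
      "Cod U ?m = FO G (EHom X x z)"
      using EComp[OF x y z] obj x y z by (simp_all add: in_Hom)
  qed
  have "U.action (lift A) x x \<cdot>\<^bsub>U\<^esub> (EId ?GX x \<otimes>\<^bsub>U\<^esub> Idn U (EFO (lift A) x)) = lun U (EFO (lift A) x)"
    if x: "x \<in> EObj X" for x
  proof -
    let ?a = "EFO A x"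
    note t = obj(1)[OF x] obj(2)[OF x x] EId[OF x, unfolded in_Hom] act[OF x x]
    have "U.action (lift A) x x \<cdot>\<^bsub>U\<^esub> (EId ?GX x \<otimes>\<^bsub>U\<^esub> Idn U (EFO (lift A) x))
        = (lax_image (EHom X x x) ?a (V.action A x x) \<cdot>\<^bsub>U\<^esub> (FA G (EId X x) \<otimes>\<^bsub>U\<^esub> Idn U (FO G ?a)))
          \<cdot>\<^bsub>U\<^esub> (lu G \<otimes>\<^bsub>U\<^esub> Idn U (FO G ?a))"
      unfolding action_Gtilde[OF A x x] EId_G using t by simp
    also have "\<dots> = lun U (EFO (lift A) x)"
      using lax_image_tensA_left[of "EId X x" ?a "V.action A x x"] lax_image_lun[of ?a] t
      by (simp add: unit_law[OF x])
    finally show ?thesis .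
  qed
  moreover have "U.action (lift A) x z \<cdot>\<^bsub>U\<^esub> (EComp ?GX x y z \<otimes>\<^bsub>U\<^esub> Idn U (EFO (lift A) x))
      = U.action (lift A) y z \<cdot>\<^bsub>U\<^esub> (Idn U (EHom ?GX y z) \<otimes>\<^bsub>U\<^esub> U.action (lift A) x y)
          \<cdot>\<^bsub>U\<^esub> asc U (EHom ?GX y z) (EHom ?GX x y) (EFO (lift A) x)"
    if x: "x \<in> EObj X" and y: "y \<in> EObj X" and z: "z \<in> EObj X" for x y z
  proof -
    let ?a = "EFO A x" and ?h = "EHom X x y" and ?k = "EHom X y z"
    let ?m = "EComp X x y z" and ?A = "V.action A"
    note t = obj(1)[OF x] obj(1)[OF y] obj(1)[OF z] obj(2)[OF x y] obj(2)[OF y z] obj(2)[OF x z]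
      EComp[OF x y z, unfolded in_Hom] act[OF x y] act[OF y z] act[OF x z]
    have "U.action (lift A) x z \<cdot>\<^bsub>U\<^esub> (EComp ?GX x y z \<otimes>\<^bsub>U\<^esub> Idn U (EFO (lift A) x))
        = lax_image (EHom X x z) ?a (?A x z) \<cdot>\<^bsub>U\<^esub> (FA G ?m \<otimes>\<^bsub>U\<^esub> Idn U (FO G ?a))
          \<cdot>\<^bsub>U\<^esub> (lm G ?k ?h \<otimes>\<^bsub>U\<^esub> Idn U (FO G ?a))"
      unfolding action_Gtilde[OF A x z] EComp_G using t by (simp add: lax_image_def)
    also have "lax_image (EHom X x z) ?a (?A x z) \<cdot>\<^bsub>U\<^esub> (FA G ?m \<otimes>\<^bsub>U\<^esub> Idn U (FO G ?a))
        = lax_image (?k \<odot>\<^bsub>V\<^esub> ?h) ?a (?A x z \<cdot>\<^bsub>V\<^esub> (?m \<otimes>\<^bsub>V\<^esub> Idn V ?a))"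
      using lax_image_tensA_left[of ?m ?a "?A x z"] t by simp
    also have "\<dots> = FA G (?A y z \<cdot>\<^bsub>V\<^esub> (Idn V ?k \<otimes>\<^bsub>V\<^esub> ?A x y))
        \<cdot>\<^bsub>U\<^esub> (FA G (asc V ?k ?h ?a) \<cdot>\<^bsub>U\<^esub> lm G (?k \<odot>\<^bsub>V\<^esub> ?h) ?a)"
      unfolding comp_law[OF x y z] lax_image_def using t by (subst G_Comp) simp_all
    also have "\<dots> \<cdot>\<^bsub>U\<^esub> (lm G ?k ?h \<otimes>\<^bsub>U\<^esub> Idn U (FO G ?a))
        = FA G (?A y z \<cdot>\<^bsub>V\<^esub> (Idn V ?k \<otimes>\<^bsub>V\<^esub> ?A x y)) \<cdot>\<^bsub>U\<^esub>
          (FA G (asc V ?k ?h ?a) \<cdot>\<^bsub>U\<^esub> lm G (?k \<odot>\<^bsub>V\<^esub> ?h) ?a \<cdot>\<^bsub>U\<^esub> (lm G ?k ?h \<otimes>\<^bsub>U\<^esub> Idn U (FO G ?a)))"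
      using t by simp
    also have "\<dots> = lax_image ?k (?h \<odot>\<^bsub>V\<^esub> ?a) (?A y z \<cdot>\<^bsub>V\<^esub> (Idn V ?k \<otimes>\<^bsub>V\<^esub> ?A x y))
        \<cdot>\<^bsub>U\<^esub> (Idn U (FO G ?k) \<otimes>\<^bsub>U\<^esub> lm G ?h ?a) \<cdot>\<^bsub>U\<^esub> asc U (FO G ?k) (FO G ?h) (FO G ?a)"
      unfolding lm_assoc[OF t(5,4,1)] lax_image_def using t by simp
    also have "lax_image ?k (?h \<odot>\<^bsub>V\<^esub> ?a) (?A y z \<cdot>\<^bsub>V\<^esub> (Idn V ?k \<otimes>\<^bsub>V\<^esub> ?A x y))
        = lax_image ?k (EFO A y) (?A y z) \<cdot>\<^bsub>U\<^esub> (Idn U (FO G ?k) \<otimes>\<^bsub>U\<^esub> FA G (?A x y))"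
      using lax_image_tensA_right[of "?A x y" ?k "?A y z"] t by simp
    also have "\<dots> \<cdot>\<^bsub>U\<^esub> (Idn U (FO G ?k) \<otimes>\<^bsub>U\<^esub> lm G ?h ?a)
        = U.action (lift A) y z \<cdot>\<^bsub>U\<^esub> (Idn U (EHom ?GX y z) \<otimes>\<^bsub>U\<^esub> U.action (lift A) x y)"
      unfolding action_Gtilde[OF A y z] action_Gtilde[OF A x y] using t by (simp add: lax_image_def)
    finally show ?thesis by simp
  qed
  moreover have "EFO (lift A) x \<in> Obj U" if "x \<in> EObj ?GX" for x using obj that by simp
  moreover have "EFA (lift A) x y \<in> Hom U (EHom ?GX x y) (ihom U (EFO (lift A) x) (EFO (lift A) y))"
    if "x \<in> EObj ?GX" "y \<in> EObj ?GX" for x y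
    using EFA_Gtilde_Hom[OF A, of x y] that by simp
  ultimately show ?thesis
    using U.enriched_functor_self_iff[OF GX, of "lift A"] unfolding base_change_cat_simps(1) by blast
qed

lemma enriched_nat_Gtilde:
  assumes X: "V.enriched_data X" and A: "enriched_functor V X (self V) A" and B: "enriched_functor V X (self V) B"
    and nat: "enriched_nat V X (self V) A B t"
  shows "enriched_nat U (base_change_cat U G X) (self U) (lift A) (lift B) (lift_nat A B t)"
  unfolding U.enriched_nat_self_iff[OF enriched_functor_Gtilde[OF X A] enriched_functor_Gtilde[OF X B]] base_change_cat_simps
proof (intro conjI ballI)
  have tx: "t x \<in> Hom V (unt V) (ihom V (EFO A x) (EFO B x))" if "x \<in> EObj X" for x
    using nat that V.enriched_nat_self_iff[OF A B] by simp
  fix x assume x: "x \<in> EObj X"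
  show "lift_nat A B t x \<in> Hom U (unt U) (ihom U (EFO (lift A) x) (EFO (lift B) x))"
    using Gtilde_nat_Hom[where t = t, OF A B x tx[OF x]] by simp
  fix y assume y: "y \<in> EObj X"
  let ?c = "V.component A B t"
  note obj = V.EFO_Obj[OF A x] V.EFO_Obj[OF B x] V.EHom_Obj[OF A x y]
  note c = V.component_Arr[where t = t, OF A B tx[OF x] x] V.Dom_component[where t = t, OF A B tx[OF x] x]
    V.Cod_component[where t = t, OF A B tx[OF x] x] V.component_Arr[where t = t, OF A B tx[OF y] y]
    V.Dom_component[where t = t, OF A B tx[OF y] y] V.Cod_component[where t = t, OF A B tx[OF y] y]
  note act = V.action_Arr[OF A x y] V.Dom_action[OF A x y] V.Cod_action[OF A x y]
    V.action_Arr[OF B x y] V.Dom_action[OF B x y] V.Cod_action[OF B x y]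
  have law: "?c y \<cdot>\<^bsub>V\<^esub> V.action A x y = V.action B x y \<cdot>\<^bsub>V\<^esub> (Idn V (EHom X x y) \<otimes>\<^bsub>V\<^esub> ?c x)"
    using nat x y V.enriched_nat_self_iff[OF A B] by simp
  show "U.component (lift A) (lift B) (lift_nat A B t) y \<cdot>\<^bsub>U\<^esub> U.action (lift A) x y
      = U.action (lift B) x y \<cdot>\<^bsub>U\<^esub> (Idn U (FO G (EHom X x y)) \<otimes>\<^bsub>U\<^esub> U.component (lift A) (lift B) (lift_nat A B t) x)"
    unfolding component_Gtilde_nat[where t = t, OF A B x tx[OF x]]
      component_Gtilde_nat[where t = t, OF A B y tx[OF y]]
      action_Gtilde[OF A x y] action_Gtilde[OF B x y]
    using lax_image_tensA_right[of "?c x" "EHom X x y" "V.action B x y"] obj c act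
    by (simp add: G_lax_image law)
qed

lemma component_Gtilde_mono:
  assumes "(R, r) \<in> Monos V X K" "x \<in> EObj X"
  shows "U.component (lift R) (lift K) (lift_nat R K r) x = FA G (V.component R K r x)"
  using assms V.Monos_component(1)[OF assms]
  by (intro component_Gtilde_nat) (simp_all add: V.Monos_iff)

lemma Gtilde_preserves_monos:
  assumes X: "V.enriched_data X" and m: "(R, r) \<in> Monos V X K"
  shows "(lift R, lift_nat R K r) \<in> Monos U (base_change_cat U G X) (lift K)"
proof -
  have R: "enriched_functor V X (self V) R" and K: "enriched_functor V X (self V) K"
    and r: "enriched_nat V X (self V) R K r"
    using m by (simp_all add: V.Monos_iff)
  have "monic U (U.component (lift R) (lift K) (lift_nat R K r) x)" if "x \<in> EObj X" for x
    unfolding component_Gtilde_mono[OF m that]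
    by (rule G_preserves_monic[OF V.Monos_component(5)[OF m that]])
  then show ?thesis
    unfolding U.Monos_iff base_change_cat_simps(1)
    using enriched_functor_Gtilde[OF X R] enriched_functor_Gtilde[OF X K]
      enriched_nat_Gtilde[OF X R K r] by blast
qed

text \<open>Both orders are pointwise, and the components of the lifted monomorphisms are the images of the
  original ones, so this is preservation and reflection of factorizations by \<open>G\<close>.\<close>

lemma Gtilde_mono_ge_iff:
  assumes X: "V.enriched_data X"
    and pullbacks: "\<And>f g. \<lbrakk>f \<in> Arr V; g \<in> Arr V; Cod V f = Cod V g\<rbrakk> \<Longrightarrow> \<exists>p q. is_pullback V f g p q"
    and cons: "conservative V U G"
    and r: "(R, r) \<in> Monos V X K" and s: "(S, s) \<in> Monos V X K"
  shows "mono_ge U (base_change_cat U G X) (lift K) (lift R, lift_nat R K r) (lift S, lift_nat S K s)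
    \<longleftrightarrow> mono_ge V X K (R, r) (S, s)"
proof -
  have "(\<exists>f\<in>Hom U (FO G (EFO S x)) (FO G (EFO R x)).
        FA G (V.component R K r x) \<cdot>\<^bsub>U\<^esub> f = FA G (V.component S K s x)) \<longleftrightarrow>
      (\<exists>f\<in>Hom V (EFO S x) (EFO R x). V.component R K r x \<cdot>\<^bsub>V\<^esub> f = V.component S K s x)"
    (is "?l \<longleftrightarrow> ?r") if x: "x \<in> EObj X" for x
  proof
    note cr = V.Monos_component[OF r x] and cs = V.Monos_component[OF s x]
    {
      assume ?l
      then obtain f where f: "f \<in> Hom U (FO G (EFO S x)) (FO G (EFO R x))"
        and e: "FA G (V.component R K r x) \<cdot>\<^bsub>U\<^esub> f = FA G (V.component S K s x)" by blast
      have "\<exists>t\<in>Hom V (Dom V (V.component S K s x)) (Dom V (V.component R K r x)).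
          V.component R K r x \<cdot>\<^bsub>V\<^esub> t = V.component S K s x"
        by (rule G_reflects_factorization[OF pullbacks cons cs(2) cr(5) _ _ e])
          (simp_all only: cr cs f)
      then show ?r unfolding cr(3) cs(3) .
    next
      assume ?r
      then obtain f where f: "f \<in> Arr V" "Dom V f = EFO S x" "Cod V f = EFO R x"
        "V.component R K r x \<cdot>\<^bsub>V\<^esub> f = V.component S K s x" by (auto simp: in_Hom)
      then have "FA G (V.component R K r x) \<cdot>\<^bsub>U\<^esub> FA G f = FA G (V.component S K s x)"
        using G_Comp[of f "V.component R K r x"] cr by simp
      moreover have "FA G f \<in> Hom U (FO G (EFO S x)) (FO G (EFO R x))" using f by (simp add: in_Hom)
      ultimately show ?l by blast
    }
  qed
  then show ?thesis
    unfolding V.mono_ge_iff[OF r s]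
      U.mono_ge_iff[OF Gtilde_preserves_monos[OF X r] Gtilde_preserves_monos[OF X s]]
    by (simp add: component_Gtilde_mono[OF r] component_Gtilde_mono[OF s])
qed

end

section \<open>Injectivity on subobjects\<close>

theorem theorem3p12:
  fixes U :: "('u, 'g) smcc" and V :: "('v, 'f) smcc"
    and F :: "('u, 'g, 'v, 'f) lax" and G :: "('v, 'f, 'u, 'g) lax"
    and eta :: "'u \<Rightarrow> 'g" and eps :: "'v \<Rightarrow> 'f"
    and C :: "('c, 'v, 'f) ecat" and K :: "('c, 'v, 'f) efun"
  defines "Cop \<equiv> op_ecat V C"
    and "GCop \<equiv> base_change_cat U G (op_ecat V C)"
    and "GK \<equiv> Gtilde U V F G eta eps K"
  assumes "universe TYPE('s)"
    and "base_of_enrichment TYPE('s) U" and "base_of_enrichment TYPE('s) V"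
    and "monoidal_adjunction U V F G eta eps"
    and "small_enriched_category TYPE('s) V C"
    and "faithful V G" and "conservative V U G"
    and "enriched_functor V Cop (self V) K"
  shows "\<exists>Gsub.
     (\<forall>R r. (R, r) \<in> Monos V Cop K \<longrightarrow>
        (Gtilde U V F G eta eps R, Gtilde_nat U V F G eta eps R K r) \<in> Monos U GCop GK \<and>
        Gsub (sub_class V Cop K (R, r))
          = sub_class U GCop GK (Gtilde U V F G eta eps R, Gtilde_nat U V F G eta eps R K r)) \<and>
     poset_morphism (Sub V Cop K) (Sub_order V Cop K) (Sub U GCop GK) (Sub_order U GCop GK) Gsub \<and>
     inj_on Gsub (Sub V Cop K)"
proof -
  interpret monoidal_adjoint_pair U V F G eta eps
    using assms(5-7)
    by (simp add: monoidal_adjoint_pair_def monoidal_adjoint_pair_axioms_def base_of_enrichment_def)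
  have GCop: "GCop = base_change_cat U G Cop" unfolding GCop_def Cop_def ..
  have X: "V.enriched_data Cop"
    unfolding Cop_def using assms(8) by (intro V.enriched_data_op) (simp add: small_enriched_category_def)
  have pullbacks: "\<exists>p q. is_pullback V f g p q"
    if "f \<in> Arr V" "g \<in> Arr V" "Cod V f = Cod V g" for f g
    using assms(6) that unfolding base_of_enrichment_def regular_category_def by blast
  define g where "g = (\<lambda>(R, r). (lift R, lift_nat R K r))"
  have g_in: "g a \<in> Monos U GCop GK" if "a \<in> Monos V Cop K" for a
    using that Gtilde_preserves_monos[OF X] unfolding g_def GCop GK_def by (cases a) simp
  have g_ge: "mono_ge U GCop GK (g a) (g b) \<longleftrightarrow> mono_ge V Cop K a b"
    if "a \<in> Monos V Cop K" "b \<in> Monos V Cop K" for a b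
  proof -
    obtain R r S s where ab: "a = (R, r)" "b = (S, s)" by (cases a, cases b)
    show ?thesis
      unfolding ab g_def prod.case GCop GK_def
      by (rule Gtilde_mono_ge_iff[OF X pullbacks assms(10) that[unfolded ab]])
  qed
  obtain h where "\<forall>a\<in>Monos V Cop K. h (mono_equiv V Cop K `` {a}) = mono_equiv U GCop GK `` {g a}"
    "poset_morphism (Sub V Cop K) (Sub_order V Cop K) (Sub U GCop GK) (Sub_order U GCop GK) h"
    "inj_on h (Sub V Cop K)"
    using order_embedding_descends_to_quotients[OF V.preordered_Monos U.preordered_Monos g_in g_ge]
    unfolding Sub_def V.Sub_order_eq U.Sub_order_eq V.mono_equiv_eq U.mono_equiv_eq by blast
  moreover have "(lift R, lift_nat R K r) \<in> Monos U GCop GK" if "(R, r) \<in> Monos V Cop K" for R r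
    using g_in[OF that] by (simp add: g_def)
  ultimately show ?thesis
    unfolding sub_class_def by (intro exI[of _ h]) (auto simp: g_def)
qed

end
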